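(* Let $\mu\in\mathbb{R}$, let $W$ be a standard Brownian motion and $X_t=W_t+\mu t$, $t\ge 0$. Let $T>0$ and $c>0$. Then, almost surely, as $n\to+\infty$, $$\frac{\mathrm{TV}^c(X,nt)}{n}\to m^c_\mu\,t,\qquad \frac{\mathrm{UTV}^c(X,nt)}{n}\to\tfrac12 n^c_{\mu}\,t,\qquad \frac{\mathrm{DTV}^c(X,nt)}{n}\to\tfrac12 n^c_{-\mu}\,t,$$ where the convergence is that of functions of $t\in[0,T]$ in $\mathcal{C}([0,T],\mathbb{R})$ (i.e. uniform in $t\in[0,T]$), and $$m^c_\mu=\begin{cases}\mu\coth(c\mu)&\text{if }\mu\ne0,\\ c^{-1}&\text{if }\mu=0,\end{cases}\qquad n^c_\mu=\begin{cases}\mu\coth(c\mu)+\mu&\text{if }\mu\neq0,\\ c^{-1}&\text{if }\mu=0.\end{cases}$$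
   Context: For $c\ge 0$ let $\phi_c(x)=\max\{x-c,0\}$. For a càdlàg function $f:[a,b]\to\mathbb{R}$ define the truncated variation, upward truncated variation and downward truncated variation by $$\mathrm{TV}^c(f,[a,b])=\sup_n\ \sup_{a\le t_1<t_2<\dots<t_n\le b}\ \sum_{i=1}^{n-1}\phi_c(|f(t_{i+1})-f(t_i)|),$$ $$\mathrm{UTV}^c(f,[a,b])=\sup_n\ \sup_{a\le t_1<s_1<t_2<s_2<\dots<t_n<s_n\le b}\ \sum_{i=1}^{n}\phi_c(f(s_i)-f(t_i)),$$ $$\mathrm{DTV}^c(f,[a,b])=\sup_n\ \sup_{a\le t_1<s_1<t_2<s_2<\dots<t_n<s_n\le b}\ \sum_{i=1}^{n}\phi_c(f(t_i)-f(s_i))$$ (all are $0$ when $a=b$). For a càdlàg process $X$ put, pathwise, $\mathrm{TV}^c(X,t)=\mathrm{TV}^c(X,[0,t])$, $\mathrm{UTV}^c(X,t)=\mathrm{UTV}^c(X,[0,t])$, $\mathrm{DTV}^c(X,t)=\mathrm{DTV}^c(X,[0,t])$. $\mathcal{C}([0,T],\mathbb{R})$ is the space of continuous functions on $[0,T]$ with the supremum norm. *)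

theory Defs
  imports "HOL-Probability.Probability"
begin

locale standard_brownian_motion = prob_space M for M :: "'a measure" +
  fixes W :: "real \<Rightarrow> 'a \<Rightarrow> real"
  assumes measurable: "\<And>t. 0 \<le> t \<Longrightarrow> W t \<in> borel_measurable M"
    and start: "AE \<omega> in M. W 0 \<omega> = 0"
    and indep_increments: "\<And>(n::nat) t. 0 \<le> t 0 \<Longrightarrow> strict_mono_on {..n} t \<Longrightarrow>
      indep_vars (\<lambda>_. borel) (\<lambda>i \<omega>. W (t (Suc i)) \<omega> - W (t i) \<omega>) {..<n}"
    and gaussian_increments: "\<And>s t. 0 \<le> s \<Longrightarrow> s < t \<Longrightarrow>
      distributed M lborel (\<lambda>\<omega>. W t \<omega> - W s \<omega>) (normal_density 0 (sqrt (t - s)))"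
    and continuous_paths: "AE \<omega> in M. continuous_on {0..} (\<lambda>t. W t \<omega>)"

definition phi :: "real \<Rightarrow> real \<Rightarrow> real" where
  "phi c x = max (x - c) 0"

definition grids :: "real \<Rightarrow> real \<Rightarrow> (nat \<times> (nat \<Rightarrow> real)) set" where
  "grids a b = {(n, t). 1 \<le> n \<and> t ` {1..n} \<subseteq> {a..b} \<and> strict_mono_on {1..n} t}"

definition interlaced_grids ::
    "real \<Rightarrow> real \<Rightarrow> (nat \<times> (nat \<Rightarrow> real) \<times> (nat \<Rightarrow> real)) set" where
  "interlaced_grids a b = {(n, t, s). 1 \<le> n \<and> a \<le> t 1 \<and> s n \<le> b \<and>
     (\<forall>i\<in>{1..n}. t i < s i) \<and> (\<forall>i\<in>{1..<n}. s i < t (Suc i))}"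

(* The suprema are taken in ennreal: they may be infinite for a general f, and the supremum
   over the empty set, which occurs for UTV and DTV when a = b, is 0. *)

definition TV :: "real \<Rightarrow> (real \<Rightarrow> real) \<Rightarrow> real \<Rightarrow> real \<Rightarrow> ennreal" where
  "TV c f a b = (SUP (n, t) \<in> grids a b. ennreal (\<Sum>i\<in>{1..<n}. phi c \<bar>f (t (Suc i)) - f (t i)\<bar>))"

definition UTV :: "real \<Rightarrow> (real \<Rightarrow> real) \<Rightarrow> real \<Rightarrow> real \<Rightarrow> ennreal" where
  "UTV c f a b = (SUP (n, t, s) \<in> interlaced_grids a b. ennreal (\<Sum>i\<in>{1..n}. phi c (f (s i) - f (t i))))"

definition DTV :: "real \<Rightarrow> (real \<Rightarrow> real) \<Rightarrow> real \<Rightarrow> real \<Rightarrow> ennreal" where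
  "DTV c f a b = (SUP (n, t, s) \<in> interlaced_grids a b. ennreal (\<Sum>i\<in>{1..n}. phi c (f (t i) - f (s i))))"

(* Convergence in C([0,T],R) of the sequence F 1, F 2, ...: besides uniform convergence this
   asserts that each F n with n >= 1 is a finite continuous function on [0,T]. The index 0 is
   excluded because F is used with a factor 1/n. *)

definition converges_in_C :: "real \<Rightarrow> (nat \<Rightarrow> real \<Rightarrow> ennreal) \<Rightarrow> (real \<Rightarrow> real) \<Rightarrow> bool" where
  "converges_in_C T F g \<longleftrightarrow>
     (\<forall>n\<ge>1. (\<forall>t\<in>{0..T}. F n t < \<top>) \<and> continuous_on {0..T} (\<lambda>t. enn2real (F n t))) \<and>
     continuous_on {0..T} g \<and>
     uniform_limit {0..T} (\<lambda>n t. enn2real (F n t)) g sequentially"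

definition coth :: "real \<Rightarrow> real" where
  "coth x = cosh x / sinh x"

definition m_const :: "real \<Rightarrow> real \<Rightarrow> real" where
  "m_const c \<mu> = (if \<mu> \<noteq> 0 then \<mu> * coth (c * \<mu>) else 1 / c)"

definition n_const :: "real \<Rightarrow> real \<Rightarrow> real" where
  "n_const c \<mu> = (if \<mu> \<noteq> 0 then \<mu> * coth (c * \<mu>) + \<mu> else 1 / c)"

end

theory Submission
  imports Defs "HOL-Real_Asymp.Real_Asymp"
begin

text \<open>
  The truncated variations are, up to a bounded error, the regulators of a two-sided reflection.
  Sample a continuous path \<open>f\<close> at the multiples of a mesh \<open>d\<close> and keep a process \<open>Y\<close> in
  \<open>[0, c]\<close> by following the increments of \<open>f\<close>, pushing down at \<open>c\<close> by amounts \<open>u\<close> and up at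
  \<open>0\<close> by amounts \<open>l\<close>. Then \<open>f - Y\<close> changes only through the pushes, and while \<open>f\<close> rises by
  \<open>x\<close> the pushes \<open>u\<close> add up to at least \<open>x - c\<close>; this bounds the upward truncated variation by
  \<open>\<Sum>u\<close> as the mesh tends to \<open>0\<close>. Conversely \<open>\<Sum>u\<close> is the profit of an
  optimal trader who pays \<open>c\<close> per round trip and can trade at the mesh points only, so it is
  attained by an interlaced grid (\<open>UTV_ge_reflection\<close>). Up to bounded errors the same
  holds for \<open>\<Sum>l\<close> and DTV, by symmetry, and for \<open>\<Sum>(u + l)\<close> and TV. Hence TV differs from UTV + DTV
  by at most \<open>2 c\<close> (\<open>TV_UTV_DTV\<close>), and since DTV is the UTV of the negated path, a Brownian path with
  drift \<open>-\<mu>\<close>, only UTV has to be studied.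

  For \<open>f u = W u + \<mu> u\<close> the process \<open>Y\<close> approximates a reflected Brownian motion. Its pushing rate at
  \<open>c\<close> is found from a function \<open>h\<close> whose derivative \<open>g\<close> satisfies \<open>g' / 2 + \<mu> g = \<kappa>\<close>,
  \<open>g 0 = 0\<close> and \<open>g c = 1\<close>, which forces \<open>\<kappa> = n_const c \<mu> / 2\<close>. A second-order Taylor expansion
  of \<open>h\<close> along one step expresses \<open>u - \<kappa> d\<close> as the telescoping term \<open>h Y - h Y'\<close>, a martingale
  increment and an error that is small for a fine mesh (\<open>corrector_step\<close>). The martingales at
  time \<open>b\<close> have second moment at most a constant times \<open>b\<close>, uniformly in the mesh. By Fatou's
  lemma the distance of \<open>UTV\<close> on \<open>[0, b]\<close> from \<open>\<kappa> b\<close> is thus bounded by a random variable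
  of order \<open>sqrt b\<close> in mean square (\<open>UTV_near_linear\<close>, \<open>corrector_martingales_L2\<close>), and summing
  over \<open>b = k\<^sup>2\<close> gives almost sure convergence of \<open>UTV / b\<close> to \<open>\<kappa>\<close> along the squares.

  The truncated variations increase with the right endpoint and the limit is linear, so the squares
  suffice for convergence at all times, uniformly on \<open>[0, T]\<close> (\<open>converges_in_C_from_squares\<close>).
\<close>

section \<open>Elementary properties of the truncated variations\<close>

lemma phi_nonneg [simp]: "0 \<le> phi c x" by (simp add: phi_def)
lemma phi_ge: "x - c \<le> phi c x" by (simp add: phi_def)
lemma phi_leI: "x - c \<le> v \<Longrightarrow> 0 \<le> v \<Longrightarrow> phi c x \<le> v" by (simp add: phi_def)
lemma phi_le_add: "phi c x \<le> phi c y + \<bar>x - y\<bar>" by (auto simp: phi_def max_def)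
lemma phi_eq_0: "x \<le> c \<Longrightarrow> phi c x = 0" by (simp add: phi_def)

lemma DTV_eq_UTV: "DTV c f a b = UTV c (\<lambda>x. - f x) a b"
  by (simp add: DTV_def UTV_def)

lemma interlaced_grids_bounds:
  assumes "(n, t, s) \<in> interlaced_grids a b" "i \<in> {1..n}"
  shows "a \<le> t i" "t i < s i" "s i \<le> b"
proof -
  have ts: "t j < s j" if "j \<in> {1..n}" for j using assms(1) that by (simp add: interlaced_grids_def)
  have st: "s j < t (Suc j)" if "j \<in> {1..<n}" for j using assms(1) that by (simp add: interlaced_grids_def)
  show "t i < s i" using ts assms(2) .
  have "1 \<le> j \<Longrightarrow> j \<le> n \<Longrightarrow> a \<le> t j" for j
  proof (induction j rule: nat_induct_at_least)
    case base
    then show ?case using assms(1) by (simp add: interlaced_grids_def)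
  next
    case (Suc j)
    then show ?case using ts[of j] st[of j] by force
  qed
  then show "a \<le> t i" using assms(2) by simp
  have "k < n \<Longrightarrow> s (n - k) \<le> b" for k
  proof (induction k)
    case 0
    then show ?case using assms(1) by (simp add: interlaced_grids_def)
  next
    case (Suc k)
    have "Suc (n - Suc k) = n - k" using Suc.prems by simp
    then show ?case using Suc st[of "n - Suc k"] ts[of "n - k"] by force
  qed
  from this[of "n - i"] show "s i \<le> b" using assms(2) by simp
qed

lemma interlaced_grids_prefix:
  assumes "(Suc n, t, s) \<in> interlaced_grids a b" "n \<ge> 1"
  shows "(n, t, s) \<in> interlaced_grids a (s n)" "s n < t (Suc n)"
  using assms by (auto simp: interlaced_grids_def)

lemma interlaced_grids_mono:
  "(n, t, s) \<in> interlaced_grids a b \<Longrightarrow> b \<le> b' \<Longrightarrow> (n, t, s) \<in> interlaced_grids a b'"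
  by (auto simp: interlaced_grids_def)

lemma grids_mono: "(n, t) \<in> grids a b \<Longrightarrow> b \<le> b' \<Longrightarrow> (n, t) \<in> grids a b'"
  by (force simp: grids_def)

lemma grids_snoc:
  assumes "(n, t) \<in> grids a b" "b < b'"
  shows "(Suc n, t(Suc n := b')) \<in> grids a b'"
proof -
  have n: "n \<ge> 1" and tin: "\<And>i. i \<in> {1..n} \<Longrightarrow> t i \<in> {a..b}" and sm: "strict_mono_on {1..n} t"
    using assms(1) by (auto simp: grids_def image_subset_iff)
  have "(t(Suc n := b')) ` {1..Suc n} \<subseteq> {a..b'}"
    using tin assms(2) n tin[of 1] by (force simp: le_Suc_eq)
  moreover have "strict_mono_on {1..Suc n} (t(Suc n := b'))"
    using tin assms(2) by (force intro!: strict_mono_onI strict_mono_onD[OF sm] simp: le_Suc_eq)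
  ultimately show ?thesis by (simp add: grids_def)
qed

text \<open>All upper bounds in this development come from a monotone \<open>V\<close> whose increments dominate the
  summands: the intervals of a grid do not overlap, so the increments add up to at most the total one.\<close>

lemma sum_interlaced_le:
  fixes V :: "real \<Rightarrow> real"
  assumes "(n, t, s) \<in> interlaced_grids a b" "a \<le> b"
    and mono: "\<And>x y. a \<le> x \<Longrightarrow> x \<le> y \<Longrightarrow> y \<le> b \<Longrightarrow> V x \<le> V y"
    and le: "\<And>x y. a \<le> x \<Longrightarrow> x \<le> y \<Longrightarrow> y \<le> b \<Longrightarrow> \<psi> x y \<le> V y - V x"
  shows "(\<Sum>i\<in>{1..n}. \<psi> (t i) (s i)) \<le> V b - V a"
proof -
  have "(n, t, s) \<in> interlaced_grids a b' \<Longrightarrow> n \<ge> 1 \<Longrightarrow> b' \<le> b \<Longrightarrow>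
      (\<Sum>i\<in>{1..n}. \<psi> (t i) (s i)) \<le> V b' - V a" for b'
  proof (induction n arbitrary: b')
    case (Suc n)
    note bd = interlaced_grids_bounds[OF Suc.prems(1), of "Suc n", simplified]
    have *: "\<psi> (t (Suc n)) (s (Suc n)) \<le> V (s (Suc n)) - V (t (Suc n))"
      "V (s (Suc n)) \<le> V b'"
      using bd Suc.prems by (auto intro: le mono)
    show ?case
    proof (cases "n \<ge> 1")
      case True
      note pre = interlaced_grids_prefix[OF Suc.prems(1) True]
      have "(\<Sum>i\<in>{1..n}. \<psi> (t i) (s i)) \<le> V (s n) - V a"
        using Suc.IH[OF pre(1)] True pre(2) bd Suc.prems by simp
      moreover have "V (s n) \<le> V (t (Suc n))"
        using interlaced_grids_bounds[OF pre(1), of n] True pre(2) bd Suc.prems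
        by (intro mono) auto
      ultimately show ?thesis using * by simp
    next
      case False
      then have "n = 0" by simp
      have "V a \<le> V (t (Suc n))" using bd Suc.prems by (intro mono) auto
      then show ?thesis using * \<open>n = 0\<close> by simp
    qed
  qed simp
  then show ?thesis using assms(1,2) mono[of a b] by (cases "n \<ge> 1") (auto simp: not_le)
qed

lemma sum_grid_le:
  fixes V :: "real \<Rightarrow> real"
  assumes "(n, t) \<in> grids a b" "a \<le> b"
    and mono: "\<And>x y. a \<le> x \<Longrightarrow> x \<le> y \<Longrightarrow> y \<le> b \<Longrightarrow> V x \<le> V y"
    and le: "\<And>x y. a \<le> x \<Longrightarrow> x \<le> y \<Longrightarrow> y \<le> b \<Longrightarrow> \<psi> x y \<le> V y - V x"
  shows "(\<Sum>i\<in>{1..<n}. \<psi> (t i) (t (Suc i))) \<le> V b - V a"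
proof -
  have n: "n \<ge> 1" and tin: "\<And>i. i \<in> {1..n} \<Longrightarrow> t i \<in> {a..b}" and sm: "strict_mono_on {1..n} t"
    using assms(1) by (auto simp: grids_def image_subset_iff)
  have "1 \<le> m \<Longrightarrow> m \<le> n \<Longrightarrow> (\<Sum>i\<in>{1..<m}. \<psi> (t i) (t (Suc i))) \<le> V (t m) - V (t 1)" for m
  proof (induction m rule: nat_induct_at_least)
    case (Suc m)
    have "t m < t (Suc m)" using sm Suc by (intro strict_mono_onD[OF sm]) auto
    then have "\<psi> (t m) (t (Suc m)) \<le> V (t (Suc m)) - V (t m)"
      using tin[of m] tin[of "Suc m"] Suc by (intro le) auto
    then show ?case using Suc by simp
  qed simp
  from this[of n] n have "(\<Sum>i\<in>{1..<n}. \<psi> (t i) (t (Suc i))) \<le> V (t n) - V (t 1)" by simp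
  also have "\<dots> \<le> V b - V a" using mono[of a "t 1"] mono[of "t n" b] tin[of 1] tin[of n] n by force
  finally show ?thesis .
qed

lemma UTV_leI:
  assumes "\<And>n t s. (n, t, s) \<in> interlaced_grids a b \<Longrightarrow> (\<Sum>i\<in>{1..n}. phi c (f (s i) - f (t i))) \<le> R"
  shows "UTV c f a b \<le> ennreal R"
  unfolding UTV_def by (intro SUP_least) (use assms in \<open>auto intro!: ennreal_leI\<close>)

lemma TV_leI:
  assumes "\<And>n t. (n, t) \<in> grids a b \<Longrightarrow> (\<Sum>i\<in>{1..<n}. phi c \<bar>f (t (Suc i)) - f (t i)\<bar>) \<le> R"
  shows "TV c f a b \<le> ennreal R"
  unfolding TV_def by (intro SUP_least) (use assms in \<open>auto intro!: ennreal_leI\<close>)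

lemma UTV_geI:
  assumes "(n, t, s) \<in> interlaced_grids a b" "v \<le> (\<Sum>i\<in>{1..n}. phi c (f (s i) - f (t i)))"
  shows "ennreal v \<le> UTV c f a b"
  unfolding UTV_def by (rule SUP_upper2[OF assms(1)]) (use assms(2) in \<open>simp add: ennreal_leI\<close>)

lemma TV_geI:
  assumes "(n, t) \<in> grids a b" "v \<le> (\<Sum>i\<in>{1..<n}. phi c \<bar>f (t (Suc i)) - f (t i)\<bar>)"
  shows "ennreal v \<le> TV c f a b"
  unfolding TV_def by (rule SUP_upper2[OF assms(1)]) (use assms(2) in \<open>simp add: ennreal_leI\<close>)

lemma UTV_mono: "b \<le> b' \<Longrightarrow> UTV c f a b \<le> UTV c f a b'"
  unfolding UTV_def by (rule SUP_subset_mono) (auto dest: interlaced_grids_mono)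

lemma TV_mono: "b \<le> b' \<Longrightarrow> TV c f a b \<le> TV c f a b'"
  unfolding TV_def by (rule SUP_subset_mono) (auto dest: grids_mono)

lemma UTV_cong: "(\<And>x. a \<le> x \<Longrightarrow> x \<le> b \<Longrightarrow> f x = f' x) \<Longrightarrow> UTV c f a b = UTV c f' a b"
proof -
  assume eq: "\<And>x. a \<le> x \<Longrightarrow> x \<le> b \<Longrightarrow> f x = f' x"
  have "f (t i) = f' (t i)" "f (s i) = f' (s i)" if g: "(n, t, s) \<in> interlaced_grids a b" "i \<in> {1..n}" for n t s i
    using interlaced_grids_bounds[OF that] by (auto intro!: eq)
  then show ?thesis unfolding UTV_def by (intro SUP_cong refl) (auto intro!: arg_cong[where f = ennreal] sum.cong)
qed

lemma TV_cong: "(\<And>x. a \<le> x \<Longrightarrow> x \<le> b \<Longrightarrow> f x = f' x) \<Longrightarrow> TV c f a b = TV c f' a b"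
proof -
  assume eq: "\<And>x. a \<le> x \<Longrightarrow> x \<le> b \<Longrightarrow> f x = f' x"
  have "f (t i) = f' (t i)" if "(n, t) \<in> grids a b" "i \<in> {1..n}" for n t i
    using that by (auto simp: grids_def image_subset_iff intro!: eq)
  then show ?thesis unfolding TV_def by (intro SUP_cong refl) (auto intro!: arg_cong[where f = ennreal] sum.cong)
qed

lemma bounded_on_Icc:
  fixes f :: "real \<Rightarrow> real"
  assumes "continuous_on {a..b} f"
  obtains B where "B \<ge> 0" "\<And>x. x \<in> {a..b} \<Longrightarrow> \<bar>f x\<bar> \<le> B"
proof -
  have "bounded (f ` {a..b})" using assms by (intro compact_imp_bounded compact_continuous_image) auto
  then obtain S where "\<forall>y\<in>f ` {a..b}. norm y \<le> S" unfolding bounded_iff by blast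
  then have "\<bar>f x\<bar> \<le> \<bar>S\<bar>" if "x \<in> {a..b}" for x using that by force
  then show ?thesis using that[of "\<bar>S\<bar>"] by simp
qed

text \<open>Uniform continuity gives \<open>d > 0\<close> such that \<open>f\<close> oscillates by less than \<open>c\<close> on intervals shorter
  than \<open>d\<close>. Truncation kills these, and on longer intervals the length is at least \<open>d\<close>, so a
  multiple of it exceeds the increment. This makes the truncated variations finite.\<close>

lemma phi_le_time:
  fixes f :: "real \<Rightarrow> real"
  assumes "c > 0" "continuous_on {a..b} f"
  obtains B where "B \<ge> 0"
    "\<And>x y. a \<le> x \<Longrightarrow> x \<le> y \<Longrightarrow> y \<le> b \<Longrightarrow> phi c \<bar>f y - f x\<bar> \<le> B * y - B * x"
proof -
  have "uniformly_continuous_on {a..b} f"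
    using assms(2) by (intro compact_uniformly_continuous) auto
  then obtain d where d: "d > 0"
    "\<And>x y. x \<in> {a..b} \<Longrightarrow> y \<in> {a..b} \<Longrightarrow> dist y x < d \<Longrightarrow> dist (f y) (f x) < c"
    unfolding uniformly_continuous_on_def using assms(1) by blast
  obtain S where S: "S \<ge> 0" "\<And>x. x \<in> {a..b} \<Longrightarrow> \<bar>f x\<bar> \<le> S"
    using bounded_on_Icc[OF assms(2)] by blast
  define B where "B = 2 * S / d"
  show ?thesis
  proof (rule that[of B])
    show "B \<ge> 0" using d S(1) by (simp add: B_def)
    fix x y assume xy: "a \<le> x" "x \<le> y" "y \<le> b"
    show "phi c \<bar>f y - f x\<bar> \<le> B * y - B * x"
    proof (cases "y - x < d")
      case True
      then have "\<bar>f y - f x\<bar> < c" using d(2)[of x y] xy by (auto simp: dist_real_def)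
      then show ?thesis using xy \<open>B \<ge> 0\<close> by (simp add: phi_eq_0 mult_left_mono)
    next
      case False
      have "\<bar>f y - f x\<bar> - c \<le> 2 * S" using S(2)[of x] S(2)[of y] xy assms(1) by auto
      also have "2 * S = B * d" using d by (simp add: B_def)
      also have "\<dots> \<le> B * (y - x)" using False \<open>B \<ge> 0\<close> by (intro mult_left_mono) auto
      finally show ?thesis using xy \<open>B \<ge> 0\<close>
        by (intro phi_leI) (auto simp: algebra_simps mult_left_mono)
    qed
  qed
qed

lemma UTV_finite:
  assumes "c > 0" "continuous_on {a..b} f" "a \<le> b"
  shows "UTV c f a b < \<top>"
proof -
  obtain B where B: "B \<ge> 0"
    "\<And>x y. a \<le> x \<Longrightarrow> x \<le> y \<Longrightarrow> y \<le> b \<Longrightarrow> phi c \<bar>f y - f x\<bar> \<le> B * y - B * x"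
    using phi_le_time[OF assms(1,2)] by blast
  have "UTV c f a b \<le> ennreal (B * b - B * a)"
  proof (rule UTV_leI)
    fix n t s assume g: "(n, t, s) \<in> interlaced_grids a b"
    show "(\<Sum>i\<in>{1..n}. phi c (f (s i) - f (t i))) \<le> B * b - B * a"
    proof (rule sum_interlaced_le[OF g assms(3)])
      fix x y assume xy: "a \<le> x" "x \<le> y" "y \<le> b"
      show "B * x \<le> B * y" using B xy by (simp add: mult_left_mono)
      show "phi c (f y - f x) \<le> B * y - B * x" using B(2)[OF xy] by (auto simp: phi_def max_def split: if_splits)
    qed
  qed
  then show ?thesis using ennreal_less_top le_less_trans by blast
qed

lemma TV_finite:
  assumes "c > 0" "continuous_on {a..b} f" "a \<le> b"
  shows "TV c f a b < \<top>"
proof -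
  obtain B where B: "B \<ge> 0"
    "\<And>x y. a \<le> x \<Longrightarrow> x \<le> y \<Longrightarrow> y \<le> b \<Longrightarrow> phi c \<bar>f y - f x\<bar> \<le> B * y - B * x"
    using phi_le_time[OF assms(1,2)] by blast
  have "TV c f a b \<le> ennreal (B * b - B * a)"
  proof (rule TV_leI)
    fix n t assume g: "(n, t) \<in> grids a b"
    show "(\<Sum>i\<in>{1..<n}. phi c \<bar>f (t (Suc i)) - f (t i)\<bar>) \<le> B * b - B * a"
      by (rule sum_grid_le[OF g assms(3)]) (use B in \<open>auto simp: mult_left_mono\<close>)
  qed
  then show ?thesis using ennreal_less_top le_less_trans by blast
qed

section \<open>Continuity in the right endpoint\<close>

text \<open>A grid that passes \<open>b\<close> can be cut there: intervals beyond \<open>b\<close> contribute nothing because the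
  oscillation \<open>e\<close> is at most \<open>c\<close>, and only one interval straddles \<open>b\<close>, at a cost of at most \<open>e\<close>.\<close>

lemma UTV_extend:
  assumes "a \<le> b" "b \<le> b'" "e \<le> c" "e \<ge> 0"
    and osc: "\<And>x y. b \<le> x \<Longrightarrow> x \<le> y \<Longrightarrow> y \<le> b' \<Longrightarrow> \<bar>f y - f x\<bar> \<le> e"
    and fin: "UTV c f a b < \<top>"
  shows "UTV c f a b' \<le> ennreal (enn2real (UTV c f a b) + e)"
proof (rule UTV_leI)
  have V: "v \<le> enn2real (UTV c f a b)" if "ennreal v \<le> UTV c f a b" for v
    using that fin by (metis enn2real_leI enn2real_nonneg ennreal_enn2real ennreal_le_iff)
  fix n t s assume "(n, t, s) \<in> interlaced_grids a b'"
  then show "(\<Sum>i\<in>{1..n}. phi c (f (s i) - f (t i))) \<le> enn2real (UTV c f a b) + e"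
  proof (induction n)
    case 0
    then show ?case using assms by simp
  next
    case (Suc n)
    note bd = interlaced_grids_bounds[OF Suc.prems, of "Suc n", simplified]
    show ?case
    proof (cases "s (Suc n) \<le> b")
      case True
      then have "(Suc n, t, s) \<in> interlaced_grids a b" using Suc.prems by (auto simp: interlaced_grids_def)
      from V[OF UTV_geI[OF this order_refl]] show ?thesis using assms by simp
    next
      case sb: False
      show ?thesis
      proof (cases "t (Suc n) \<ge> b")
        case True
        have z: "phi c (f (s (Suc n)) - f (t (Suc n))) = 0"
          using osc[of "t (Suc n)" "s (Suc n)"] True bd assms(3) by (intro phi_eq_0) force
        show ?thesis
        proof (cases "n \<ge> 1")
          case True
          have "(n, t, s) \<in> interlaced_grids a b'"
            using interlaced_grids_prefix[OF Suc.prems True] bd by (auto intro: interlaced_grids_mono)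
          from Suc.IH[OF this] z show ?thesis by simp
        next
          case False
          then show ?thesis using z assms by (simp add: not_le)
        qed
      next
        case False
        have "(Suc n, t, s(Suc n := b)) \<in> interlaced_grids a b"
          using Suc.prems False by (auto simp: interlaced_grids_def)
        from V[OF UTV_geI[OF this order_refl]]
        have "(\<Sum>i\<in>{1..n}. phi c (f (s i) - f (t i))) + phi c (f b - f (t (Suc n))) \<le> enn2real (UTV c f a b)"
          by simp
        moreover have "phi c (f (s (Suc n)) - f (t (Suc n))) \<le> phi c (f b - f (t (Suc n))) + e"
          using phi_le_add[of c "f (s (Suc n)) - f (t (Suc n))" "f b - f (t (Suc n))"] osc[of b "s (Suc n)"] sb bd
          by simp
        ultimately show ?thesis by simp
      qed
    qed
  qed
qed

lemma TV_extend:
  assumes "a \<le> b" "b \<le> b'" "e \<le> c" "e \<ge> 0"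
    and osc: "\<And>x y. b \<le> x \<Longrightarrow> x \<le> y \<Longrightarrow> y \<le> b' \<Longrightarrow> \<bar>f y - f x\<bar> \<le> e"
    and fin: "TV c f a b < \<top>"
  shows "TV c f a b' \<le> ennreal (enn2real (TV c f a b) + e)"
proof (rule TV_leI)
  have V: "v \<le> enn2real (TV c f a b)" if "ennreal v \<le> TV c f a b" for v
    using that fin by (metis enn2real_leI enn2real_nonneg ennreal_enn2real ennreal_le_iff)
  fix n t assume "(n, t) \<in> grids a b'"
  then show "(\<Sum>i\<in>{1..<n}. phi c \<bar>f (t (Suc i)) - f (t i)\<bar>) \<le> enn2real (TV c f a b) + e"
  proof (induction n)
    case 0
    then show ?case using assms by simp
  next
    case (Suc n)
    have tb: "t i \<in> {a..b'}" if "i \<in> {1..Suc n}" for i using Suc.prems that by (simp add: grids_def image_subset_iff)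
    have sm: "strict_mono_on {1..Suc n} t" using Suc.prems by (simp add: grids_def)
    show ?case
    proof (cases "n \<ge> 1")
      case n: True
      have tt: "t n < t (Suc n)" using sm n by (intro strict_mono_onD[OF sm]) auto
      have tle: "t i \<le> t (Suc n)" if "i \<in> {1..Suc n}" for i
        using that by (intro monotone_onD[OF strict_mono_on_imp_mono_on[OF sm]]) auto
      show ?thesis
      proof (cases "t (Suc n) \<le> b")
        case True
        then have "(Suc n, t) \<in> grids a b" using Suc.prems tle tb by (force simp: grids_def)
        from V[OF TV_geI[OF this order_refl]] show ?thesis using assms by simp
      next
        case sb: False
        show ?thesis
        proof (cases "t n \<ge> b")
          case True
          have z: "phi c \<bar>f (t (Suc n)) - f (t n)\<bar> = 0"
            using osc[of "t n" "t (Suc n)"] True tt tb[of "Suc n"] assms(3) by (intro phi_eq_0) force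
          have "(n, t) \<in> grids a b'"
            using Suc.prems n by (auto simp: grids_def intro: monotone_on_subset)
          from Suc.IH[OF this] z n show ?thesis by simp
        next
          case False
          have tle: "t i \<le> t n" if "i \<in> {1..n}" for i
            using that by (intro monotone_onD[OF strict_mono_on_imp_mono_on[OF sm]]) auto
          have "(n, t) \<in> grids a (t n)" using Suc.prems n tle by (force simp: grids_def intro: monotone_on_subset)
          from grids_snoc[OF this, of b] False
          have "(Suc n, t(Suc n := b)) \<in> grids a b" by simp
          from V[OF TV_geI[OF this order_refl]] n
          have "(\<Sum>i\<in>{1..<n}. phi c \<bar>f (t (Suc i)) - f (t i)\<bar>) + phi c \<bar>f b - f (t n)\<bar> \<le> enn2real (TV c f a b)"
            by simp
          moreover have "phi c \<bar>f (t (Suc n)) - f (t n)\<bar> \<le> phi c \<bar>f b - f (t n)\<bar> + e"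
            using phi_le_add[of c "\<bar>f (t (Suc n)) - f (t n)\<bar>" "\<bar>f b - f (t n)\<bar>"]
              osc[of b "t (Suc n)"] sb tb[of "Suc n"]
            by simp
          ultimately show ?thesis using n by simp
        qed
      qed
    next
      case False
      then show ?thesis using assms by (simp add: not_le)
    qed
  qed
qed

lemma continuous_on_of_extend:
  fixes f w :: "real \<Rightarrow> real"
  assumes cont: "continuous_on {0..b} f" and c: "c > 0"
    and mono: "\<And>x y. 0 \<le> x \<Longrightarrow> x \<le> y \<Longrightarrow> y \<le> b \<Longrightarrow> w x \<le> w y"
    and ext: "\<And>x y e. 0 \<le> x \<Longrightarrow> x \<le> y \<Longrightarrow> y \<le> b \<Longrightarrow> 0 \<le> e \<Longrightarrow> e \<le> c \<Longrightarrow>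
      (\<And>p q. x \<le> p \<Longrightarrow> p \<le> q \<Longrightarrow> q \<le> y \<Longrightarrow> \<bar>f q - f p\<bar> \<le> e) \<Longrightarrow> w y \<le> w x + e"
  shows "continuous_on {0..b} w"
proof (rule uniformly_continuous_imp_continuous, unfold uniformly_continuous_on_def, intro allI impI)
  fix e :: real assume e: "e > 0"
  define e' where "e' = min (e / 2) c"
  have e': "e' > 0" "e' \<le> c" "e' < e" using e c by (auto simp: e'_def)
  have "uniformly_continuous_on {0..b} f"
    using cont by (intro compact_uniformly_continuous) auto
  then obtain d where d: "d > 0"
    "\<And>x y. x \<in> {0..b} \<Longrightarrow> y \<in> {0..b} \<Longrightarrow> dist y x < d \<Longrightarrow> dist (f y) (f x) < e'"
    unfolding uniformly_continuous_on_def using e'(1) by blast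
  have *: "\<bar>w y - w x\<bar> < e" if "0 \<le> x" "x \<le> y" "y \<le> b" "y - x < d" for x y
  proof -
    have "w y \<le> w x + e'"
    proof (rule ext)
      fix p q assume "x \<le> p" "p \<le> q" "q \<le> y"
      then have "dist (f q) (f p) < e'" using that by (intro d(2)) (auto simp: dist_real_def)
      then show "\<bar>f q - f p\<bar> \<le> e'" by (simp add: dist_real_def)
    qed (use that e' in auto)
    then show ?thesis using mono[OF that(1-3)] e' by linarith
  qed
  show "\<exists>d>0. \<forall>x\<in>{0..b}. \<forall>y\<in>{0..b}. dist y x < d \<longrightarrow> dist (w y) (w x) < e"
  proof (intro exI[of _ d] conjI d(1) ballI impI)
    fix x y assume "x \<in> {0..b}" "y \<in> {0..b}" "dist y x < d"
    then show "dist (w y) (w x) < e"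
      using *[of x y] *[of y x] by (cases "x \<le> y") (auto simp: dist_real_def abs_minus_commute)
  qed
qed

lemma UTV_continuous:
  assumes cont: "continuous_on {0..b} f" and c: "c > 0"
  shows "continuous_on {0..b} (\<lambda>t. enn2real (UTV c f 0 t))"
proof (rule continuous_on_of_extend[OF cont c])
  have fin: "UTV c f 0 x < \<top>" if "0 \<le> x" "x \<le> b" for x
    using that by (intro UTV_finite c continuous_on_subset[OF cont]) auto
  fix x y assume xy: "0 \<le> x" "x \<le> y" "y \<le> b"
  show "enn2real (UTV c f 0 x) \<le> enn2real (UTV c f 0 y)"
    using UTV_mono[OF xy(2)] fin[of y] xy by (intro enn2real_mono) auto
  fix e assume "0 \<le> e" "e \<le> c" "\<And>p q. x \<le> p \<Longrightarrow> p \<le> q \<Longrightarrow> q \<le> y \<Longrightarrow> \<bar>f q - f p\<bar> \<le> e"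
  then have "UTV c f 0 y \<le> ennreal (enn2real (UTV c f 0 x) + e)"
    using xy fin[of x] by (intro UTV_extend[where c = c]) auto
  then show "enn2real (UTV c f 0 y) \<le> enn2real (UTV c f 0 x) + e"
    using \<open>0 \<le> e\<close> by (intro enn2real_leI) auto
qed

lemma TV_continuous:
  assumes cont: "continuous_on {0..b} f" and c: "c > 0"
  shows "continuous_on {0..b} (\<lambda>t. enn2real (TV c f 0 t))"
proof (rule continuous_on_of_extend[OF cont c])
  have fin: "TV c f 0 x < \<top>" if "0 \<le> x" "x \<le> b" for x
    using that by (intro TV_finite c continuous_on_subset[OF cont]) auto
  fix x y assume xy: "0 \<le> x" "x \<le> y" "y \<le> b"
  show "enn2real (TV c f 0 x) \<le> enn2real (TV c f 0 y)"
    using TV_mono[OF xy(2)] fin[of y] xy by (intro enn2real_mono) auto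
  fix e assume "0 \<le> e" "e \<le> c" "\<And>p q. x \<le> p \<Longrightarrow> p \<le> q \<Longrightarrow> q \<le> y \<Longrightarrow> \<bar>f q - f p\<bar> \<le> e"
  then have "TV c f 0 y \<le> ennreal (enn2real (TV c f 0 x) + e)"
    using xy fin[of x] by (intro TV_extend[where c = c]) auto
  then show "enn2real (TV c f 0 y) \<le> enn2real (TV c f 0 x) + e"
    using \<open>0 \<le> e\<close> by (intro enn2real_leI) auto
qed

section \<open>Two-sided reflection of a sequence\<close>

text \<open>The Skorokhod problem in \<open>[0, c]\<close> for the sequence \<open>z\<close>. It is stated as a relation rather than
  through a recursion so that it is visibly invariant under negation of \<open>z\<close>, which exchanges the
  two barriers and allows any starting point \<open>Y 0\<close>.\<close>

definition reflection ::
    "real \<Rightarrow> (nat \<Rightarrow> real) \<Rightarrow> (nat \<Rightarrow> real) \<Rightarrow> (nat \<Rightarrow> real) \<Rightarrow> (nat \<Rightarrow> real) \<Rightarrow> bool" where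
  "reflection c z Y u l \<longleftrightarrow> (\<forall>k. 0 \<le> Y k \<and> Y k \<le> c \<and> 0 \<le> u k \<and> 0 \<le> l k \<and>
     Y (Suc k) = Y k + (z (Suc k) - z k) - u k + l k \<and>
     (u k > 0 \<longrightarrow> Y (Suc k) = c) \<and> (l k > 0 \<longrightarrow> Y (Suc k) = 0))"

lemma reflectionD:
  assumes "reflection c z Y u l"
  shows "0 \<le> Y k" "Y k \<le> c" "0 \<le> u k" "0 \<le> l k"
    "Y (Suc k) = Y k + (z (Suc k) - z k) - u k + l k"
    "u k > 0 \<Longrightarrow> Y (Suc k) = c" "l k > 0 \<Longrightarrow> Y (Suc k) = 0"
  using assms by (auto simp: reflection_def)

lemma reflection_uminus:
  "reflection c z Y u l \<Longrightarrow> reflection c (\<lambda>k. - z k) (\<lambda>k. c - Y k) l u"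
  by (auto simp: reflection_def)

text \<open>The solution started at \<open>0\<close>, as a function of the increments \<open>x\<close> of \<open>z\<close>.\<close>

primrec refl_path :: "real \<Rightarrow> (nat \<Rightarrow> real) \<Rightarrow> nat \<Rightarrow> real" where
  "refl_path c x 0 = 0"
| "refl_path c x (Suc k) = max 0 (min c (refl_path c x k + x k))"

definition push_down :: "real \<Rightarrow> (nat \<Rightarrow> real) \<Rightarrow> nat \<Rightarrow> real" where
  "push_down c x k = max 0 (refl_path c x k + x k - c)"

definition push_up :: "real \<Rightarrow> (nat \<Rightarrow> real) \<Rightarrow> nat \<Rightarrow> real" where
  "push_up c x k = max 0 (- (refl_path c x k + x k))"

lemma refl_path_bounds: "c > 0 \<Longrightarrow> 0 \<le> refl_path c x k \<and> refl_path c x k \<le> c"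
  by (cases k) auto

lemma reflection_refl_path:
  assumes "c > 0" "\<And>k. x k = z (Suc k) - z k"
  shows "reflection c z (refl_path c x) (push_down c x) (push_up c x)"
  using assms refl_path_bounds[OF assms(1), of x]
  by (auto simp: reflection_def push_down_def push_up_def max_def min_def)

lemma reflection_total:
  assumes "reflection c z Y u l"
  shows "z n - z 0 = Y n - Y 0 + (\<Sum>k<n. u k) - (\<Sum>k<n. l k)"
proof (induction n)
  case (Suc n)
  then show ?case using reflectionD(5)[OF assms, of n] by simp
qed simp

text \<open>A rise of \<open>z\<close> that is not pushed away has to be absorbed by \<open>Y\<close>, which has room for \<open>c\<close> only.\<close>

lemma reflection_increase_le:
  assumes r: "reflection c z Y u l" and "i \<le> j"
  shows "z j - z i - c \<le> (\<Sum>k<j. u k) - (\<Sum>k<i. u k)"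
proof -
  have "z j - z i = Y j - Y i + ((\<Sum>k<j. u k) - (\<Sum>k<i. u k)) - ((\<Sum>k<j. l k) - (\<Sum>k<i. l k))"
    using reflection_total[OF r, of j] reflection_total[OF r, of i] by simp
  moreover have "(\<Sum>k<i. l k) \<le> (\<Sum>k<j. l k)"
    using assms by (intro sum_mono2) (auto dest: reflectionD)
  ultimately show ?thesis using reflectionD(1)[OF r, of i] reflectionD(2)[OF r, of j] by linarith
qed

lemma phi_reflection_le:
  assumes r: "reflection c z Y u l" and "i \<le> j"
  shows "phi c (z j - z i) \<le> (\<Sum>k<j. u k) - (\<Sum>k<i. u k)"
    and "phi c \<bar>z j - z i\<bar> \<le> (\<Sum>k<j. u k + l k) - (\<Sum>k<i. u k + l k)"
proof -
  have u: "(\<Sum>k<i. u k) \<le> (\<Sum>k<j. u k)" and l: "(\<Sum>k<i. l k) \<le> (\<Sum>k<j. l k)"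
    using assms by (auto intro!: sum_mono2 dest: reflectionD)
  show "phi c (z j - z i) \<le> (\<Sum>k<j. u k) - (\<Sum>k<i. u k)"
    using reflection_increase_le[OF assms] u by (intro phi_leI) auto
  show "phi c \<bar>z j - z i\<bar> \<le> (\<Sum>k<j. u k + l k) - (\<Sum>k<i. u k + l k)"
    using reflection_increase_le[OF assms] reflection_increase_le[OF reflection_uminus[OF r] assms(2)] u l
    by (intro phi_leI) (auto simp: sum.distrib abs_if)
qed

text \<open>Read \<open>f\<close> as a price: a grid buys at \<open>t i\<close>, sells at \<open>s i\<close> and pays \<open>c\<close> per round trip.
  The profits after \<open>k\<close> steps without and with an open position are tracked simultaneously;
  their difference is \<open>z k - Y k\<close>. A push down is an improvement by selling now, a push up is an
  improvement by buying now. They never happen at the same step, so the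
  strict inequalities between the grid points are preserved.\<close>

lemma UTV_ge_reflection:
  assumes c: "c > 0" and d: "d > 0" and r: "reflection c (\<lambda>k. f (real k * d)) Y u l"
  shows "ennreal ((\<Sum>k<m. u k) - Y 0) \<le> UTV c f 0 (real m * d)"
proof -
  define z where "z = (\<lambda>k. f (real k * d))"
  have rz: "reflection c z Y u l" using r by (simp add: z_def)
  let ?S = "\<lambda>n t s. \<Sum>i\<in>{1..n}. phi c (f (s i) - f (t i))"
  \<comment> \<open>An interlaced grid is non-empty, so the profit \<open>0\<close> of not trading is a separate case.\<close>
  define closed where "closed k v \<longleftrightarrow> v \<le> 0 \<or> (\<exists>n t s. (n, t, s) \<in> interlaced_grids 0 (real k * d) \<and> v \<le> ?S n t s)" for k v
  define op where "op k v \<longleftrightarrow> (\<exists>n t s. (\<forall>i\<in>{1..n}. t i < s i \<and> s i < t (Suc i)) \<and> 0 \<le> t (1::nat) \<and>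
      t (Suc n) \<le> real k * d \<and> v \<le> ?S n t s - f (t (Suc n)))" for k v
  have "closed k ((\<Sum>k<k. u k) - Y 0) \<and> op k ((\<Sum>k<k. u k) - z k + Y k - Y 0)" for k
  proof (induction k)
    case 0
    have "closed 0 (0 - Y 0)" unfolding closed_def
      using reflectionD(1)[OF r, of 0] by simp
    moreover have "op 0 (- z 0)" unfolding op_def z_def
      by (intro exI[of _ 0] exI[of _ "\<lambda>_. 0"]) auto
    ultimately show ?case by simp
  next
    case (Suc k)
    have step: "real k * d < real (Suc k) * d" using d by simp
    note R = reflectionD[OF rz, of k]
    have A: "closed (Suc k) ((\<Sum>k<Suc k. u k) - Y 0)"
    proof (cases "u k > 0")
      case False
      then have "u k = 0" using R by simp
      then show ?thesis using Suc step unfolding closed_def by (force intro: interlaced_grids_mono)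
    next
      case True
      from Suc obtain n t s where nts: "\<forall>i\<in>{1..n}. t i < s i \<and> s i < t (Suc i)" "0 \<le> t 1"
        "t (Suc n) \<le> real k * d" "(\<Sum>k<k. u k) - z k + Y k - Y 0 \<le> ?S n t s - f (t (Suc n))"
        unfolding op_def by auto
      let ?s = "s(Suc n := real (Suc k) * d)"
      have "(Suc n, t, ?s) \<in> interlaced_grids 0 (real (Suc k) * d)"
        using nts step by (auto simp: interlaced_grids_def)
      moreover have "(\<Sum>k<Suc k. u k) - Y 0 \<le> ?S (Suc n) t ?s"
      proof -
        have "l k = 0" using R True c by force
        then have "Y k + (z (Suc k) - z k) = c + u k" using R True by simp
        moreover have "?S (Suc n) t ?s = ?S n t s + phi c (z (Suc k) - f (t (Suc n)))"
          by (simp add: z_def)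
        ultimately show ?thesis
          using phi_ge[of "z (Suc k) - f (t (Suc n))" c] nts(4) by simp
      qed
      ultimately show ?thesis unfolding closed_def by blast
    qed
    have B: "op (Suc k) ((\<Sum>k<Suc k. u k) - z (Suc k) + Y (Suc k) - Y 0)"
    proof (cases "l k > 0")
      case False
      then have "l k = 0" using R by simp
      then have "(\<Sum>k<Suc k. u k) - z (Suc k) + Y (Suc k) - Y 0 = (\<Sum>k<k. u k) - z k + Y k - Y 0"
        using R by simp
      then show ?thesis using Suc step unfolding op_def by force
    next
      case True
      then have Y: "Y (Suc k) = 0" "u k = 0" using R c by force+
      show ?thesis
      proof (cases "(\<Sum>k<k. u k) - Y 0 \<le> 0")
        case True
        then show ?thesis using Y d unfolding op_def z_def
          by (intro exI[of _ 0] exI[of _ "\<lambda>_. real (Suc k) * d"]) auto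
      next
        case False
        then obtain n t s where nts: "(n, t, s) \<in> interlaced_grids 0 (real k * d)"
         "(\<Sum>k<k. u k) - Y 0 \<le> ?S n t s" using Suc unfolding closed_def by auto
      let ?t = "t(Suc n := real (Suc k) * d)"
      have "n \<ge> 1" "0 \<le> t 1" "s n \<le> real k * d" "\<And>i. i \<in> {1..n} \<Longrightarrow> t i < s i"
          "\<And>i. i \<in> {1..<n} \<Longrightarrow> s i < t (Suc i)"
        using nts(1) by (auto simp: interlaced_grids_def)
      then have "\<forall>i\<in>{1..n}. ?t i < s i \<and> s i < ?t (Suc i)" "0 \<le> ?t 1"
        using step by auto
      moreover have "(\<Sum>k<Suc k. u k) - z (Suc k) + Y (Suc k) - Y 0 \<le> ?S n ?t s - f (?t (Suc n))"
        using nts(2) Y by (simp add: z_def)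
      ultimately show ?thesis unfolding op_def
        by (intro exI[of _ n] exI[of _ ?t] exI[of _ s]) auto
      qed
    qed
    show ?case using A B ..
  qed
  then have "closed m ((\<Sum>k<m. u k) - Y 0)" by blast
  then show ?thesis
    unfolding closed_def by (elim disjE exE conjE) (simp add: ennreal_neg, rule UTV_geI)
qed

text \<open>Here the induction tracks grids that end low and grids that end high, measured by the sum minus
  or plus the last value of \<open>f\<close>. A push at either barrier is the moment at which adding the
  current point turns one kind into a better one of the other kind.\<close>

lemma TV_ge_reflection:
  assumes c: "c > 0" and d: "d > 0" and r: "reflection c (\<lambda>k. f (real k * d)) Y u l"
  shows "ennreal ((\<Sum>k<m. u k + l k) - 2 * c) \<le> TV c f 0 (real m * d)"
proof -
  define z where "z = (\<lambda>k. f (real k * d))"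
  have rz: "reflection c z Y u l" using r by (simp add: z_def)
  let ?S = "\<lambda>n t. \<Sum>i\<in>{1..<n}. phi c \<bar>f (t (Suc i)) - f (t i)\<bar>"
  \<comment> \<open>\<open>\<sigma> = -1\<close> is for grids that end low, \<open>\<sigma> = 1\<close> for grids that end high.\<close>
  define P where "P \<sigma> k v \<longleftrightarrow> (\<exists>n t. (n, t) \<in> grids 0 (real k * d) \<and> v \<le> ?S n t + \<sigma> * f (t n))" for \<sigma> k v
  have step: "real k * d < real (Suc k) * d" for k using d by simp
  have Pmono: "P \<sigma> k v \<Longrightarrow> P \<sigma> (Suc k) v" for \<sigma> k v
    using step[of k] unfolding P_def by (force intro: grids_mono)
  have Psnoc: "P (- \<sigma>) (Suc k) (v - 2 * \<sigma> * z (Suc k) - c)" if "P \<sigma> k v" "\<bar>\<sigma>\<bar> = 1" for \<sigma> k v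
  proof -
    from that obtain n t where nt: "(n, t) \<in> grids 0 (real k * d)" "v \<le> ?S n t + \<sigma> * f (t n)"
      unfolding P_def by auto
    have n: "n \<ge> 1" using nt by (simp add: grids_def)
    let ?t = "t(Suc n := real (Suc k) * d)"
    have "?S (Suc n) ?t = ?S n t + phi c \<bar>z (Suc k) - f (t n)\<bar>"
      using n by (auto simp: z_def intro!: sum.cong)
    moreover have "\<sigma> * (f (t n) - z (Suc k)) \<le> \<bar>z (Suc k) - f (t n)\<bar>"
      using that(2) by (auto simp: abs_if split: if_splits)
    ultimately have "v - 2 * \<sigma> * z (Suc k) - c \<le> ?S (Suc n) ?t + (- \<sigma>) * f (?t (Suc n))"
      using phi_ge[of "\<bar>z (Suc k) - f (t n)\<bar>" c] nt(2) unfolding z_def by (simp add: algebra_simps)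
    then show ?thesis unfolding P_def using grids_snoc[OF nt(1) step] by blast
  qed
  have "P (-1) k ((\<Sum>k<k. u k + l k) - (z k - Y k) - c) \<and> P 1 k ((\<Sum>k<k. u k + l k) + (z k - Y k))" for k
  proof (induction k)
    case 0
    have "(1, \<lambda>_. 0) \<in> grids 0 (real 0 * d)" by (auto simp: grids_def strict_mono_on_def)
    then show ?case unfolding P_def z_def
      using reflectionD(1,2)[OF r, of 0] by (force intro: exI[of _ 1] exI[of _ "\<lambda>_. 0"])
  next
    case (Suc k)
    note R = reflectionD[OF rz, of k]
    have A: "P (-1) (Suc k) ((\<Sum>k<Suc k. u k + l k) - (z (Suc k) - Y (Suc k)) - c)"
    proof (cases "l k > 0")
      case False
      then have "l k = 0" using R by simp
      then have eq: "(\<Sum>k<Suc k. u k + l k) - (z (Suc k) - Y (Suc k)) = (\<Sum>k<k. u k + l k) - (z k - Y k)"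
        using R by simp
      show ?thesis unfolding eq by (rule Pmono[OF conjunct1[OF Suc]])
    next
      case True
      then have Y: "Y (Suc k) = 0" "u k = 0" using R c by force+
      have eq: "(\<Sum>k<Suc k. u k + l k) - (z (Suc k) - Y (Suc k)) - c
          = (\<Sum>k<k. u k + l k) + (z k - Y k) - 2 * 1 * z (Suc k) - c"
        using R Y by simp
      show ?thesis unfolding eq using Psnoc[OF conjunct2[OF Suc]] by simp
    qed
    have B: "P 1 (Suc k) ((\<Sum>k<Suc k. u k + l k) + (z (Suc k) - Y (Suc k)))"
    proof (cases "u k > 0")
      case False
      then have "u k = 0" using R by simp
      then have eq: "(\<Sum>k<Suc k. u k + l k) + (z (Suc k) - Y (Suc k)) = (\<Sum>k<k. u k + l k) + (z k - Y k)"
        using R by simp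
      show ?thesis unfolding eq by (rule Pmono[OF conjunct2[OF Suc]])
    next
      case True
      then have Y: "Y (Suc k) = c" "l k = 0" using R c by force+
      have eq: "(\<Sum>k<Suc k. u k + l k) + (z (Suc k) - Y (Suc k))
          = (\<Sum>k<k. u k + l k) - (z k - Y k) - c - 2 * (- 1) * z (Suc k) - c"
        using R Y by simp
      show ?thesis unfolding eq using Psnoc[OF conjunct1[OF Suc]] by simp
    qed
    show ?case using A B ..
  qed
  then have "P (-1) m ((\<Sum>k<m. u k + l k) - (z m - Y m) - c)" by blast
  then obtain n t where nt: "(n, t) \<in> grids 0 (real m * d)"
      "(\<Sum>k<m. u k + l k) - (z m - Y m) - c \<le> ?S n t - f (t n)"
    unfolding P_def by auto
  note Ym = reflectionD(1,2)[OF r, of m]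
  have n: "n \<ge> 1" and tn: "t n \<in> {0..real m * d}" and sm: "strict_mono_on {1..n} t"
    using nt(1) by (auto simp: grids_def image_subset_iff)
  show ?thesis
  proof (cases "t n = real m * d")
    case True
    then show ?thesis using nt Ym c unfolding z_def by (intro TV_geI[OF nt(1)]) auto
  next
    case False
    have tle: "t i \<le> t n" if "i \<in> {1..n}" for i
      using that by (intro monotone_onD[OF strict_mono_on_imp_mono_on[OF sm]]) auto
    have "(n, t) \<in> grids 0 (t n)" using nt(1) tle by (force simp: grids_def)
    from grids_snoc[OF this, of "real m * d"] False tn
    have g: "(Suc n, t(Suc n := real m * d)) \<in> grids 0 (real m * d)" by auto
    have "?S (Suc n) (t(Suc n := real m * d)) = ?S n t + phi c \<bar>z m - f (t n)\<bar>"
      using n by (auto simp: z_def intro!: sum.cong)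
    then show ?thesis using phi_ge[of "\<bar>z m - f (t n)\<bar>" c] nt(2) Ym
      by (intro TV_geI[OF g]) auto
  qed
qed

section \<open>Reflection along refining meshes\<close>

lemma mesh_approx:
  fixes f :: "real \<Rightarrow> real"
  assumes "continuous_on {0..b} f" "b > 0" "e > 0"
  shows "eventually (\<lambda>N. N \<ge> 1 \<and>
    (\<forall>x\<in>{0..b}. \<bar>f (real (nat \<lfloor>x / (b / real N)\<rfloor>) * (b / real N)) - f x\<bar> \<le> e)) sequentially"
proof -
  have "uniformly_continuous_on {0..b} f"
    using assms(1) by (intro compact_uniformly_continuous) auto
  then obtain d where d: "d > 0"
    "\<And>x y. x \<in> {0..b} \<Longrightarrow> y \<in> {0..b} \<Longrightarrow> dist y x < d \<Longrightarrow> dist (f y) (f x) < e"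
    unfolding uniformly_continuous_on_def using assms(3) by blast
  obtain N0 where N0: "b / d < real N0" using reals_Archimedean2 by blast
  show ?thesis
    unfolding eventually_sequentially
  proof (intro exI[of _ "Suc N0"] allI impI conjI ballI)
    fix N x assume N: "Suc N0 \<le> N" and x: "x \<in> {0..b}"
    define D where "D = b / real N"
    have "b / d < real N" using N N0 by simp
    then have "b < real N * d" using d by (simp add: divide_less_eq)
    then have D: "D > 0" "D < d" using N assms(2) by (auto simp: D_def divide_less_eq mult.commute)
    define k where "k = nat \<lfloor>x / D\<rfloor>"
    have "real k \<le> x / D" "x / D < real k + 1"
      using x D by (auto simp: k_def)
    then have k: "real k * D \<le> x" "x < real k * D + D" using D by (simp_all add: field_simps)
    have "0 \<le> real k * D" using D by simp
    then have "dist (f (real k * D)) (f x) < e"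
      using k x D by (intro d(2)) (auto simp: dist_real_def)
    then show "\<bar>f (real (nat \<lfloor>x / (b / real N)\<rfloor>) * (b / real N)) - f x\<bar> \<le> e"
      by (simp add: D_def k_def dist_real_def)
  qed simp
qed

lemma floor_mesh_mono: "0 \<le> x \<Longrightarrow> x \<le> y \<Longrightarrow> D > 0 \<Longrightarrow> nat \<lfloor>x / D\<rfloor> \<le> nat \<lfloor>y / (D::real)\<rfloor>"
  by (intro nat_mono floor_mono divide_right_mono) auto

text \<open>Take one grid that nearly attains the supremum and round its points down to the mesh. This
  changes the sum little once the mesh is fine, and at mesh points \<open>phi_reflection_le\<close> applies.\<close>

lemma UTV_eventually_le_reflection:
  assumes cont: "continuous_on {0..b} f" and b: "b > 0" and c: "c > 0"
    and r: "\<And>N. N \<ge> 1 \<Longrightarrow> reflection c (\<lambda>k. f (real k * (b / real N))) (Y N) (u N) (l N)"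
    and e: "e > 0"
  shows "eventually (\<lambda>N. enn2real (UTV c f 0 b) \<le> (\<Sum>k<N. u N k) + e) sequentially"
proof (cases "enn2real (UTV c f 0 b) = 0")
  case True
  have "enn2real (UTV c f 0 b) \<le> (\<Sum>k<N. u N k) + e" if "N \<ge> 1" for N
    using True e reflectionD(3)[OF r[OF that]] by (simp add: sum_nonneg add_nonneg_nonneg less_imp_le)
  then show ?thesis unfolding eventually_sequentially by blast
next
  case False
  have fin: "UTV c f 0 b < \<top>" using UTV_finite[OF c cont] b by simp
  let ?U = "enn2real (UTV c f 0 b)"
  have U: "?U > 0" using False by (simp add: less_le)
  have "ennreal (?U - e / 2) < UTV c f 0 b"
  proof -
    have "ennreal (?U - e / 2) < ennreal ?U" using U e by (intro ennreal_lessI) auto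
    then show ?thesis using fin by simp
  qed
  then obtain n t s where g: "(n, t, s) \<in> interlaced_grids 0 b"
    and less: "ennreal (?U - e / 2) < ennreal (\<Sum>i\<in>{1..n}. phi c (f (s i) - f (t i)))"
    unfolding UTV_def less_SUP_iff by auto
  have S: "?U - e / 2 < (\<Sum>i\<in>{1..n}. phi c (f (s i) - f (t i)))"
  proof (rule ccontr)
    assume "\<not> ?thesis"
    then have "ennreal (\<Sum>i\<in>{1..n}. phi c (f (s i) - f (t i))) \<le> ennreal (?U - e / 2)"
      by (intro ennreal_leI) simp
    with less show False by simp
  qed
  define h where "h = e / (4 * real (Suc n))"
  have h: "h > 0" using e by (simp add: h_def)
  from mesh_approx[OF cont b h] show ?thesis
  proof eventually_elim
    case (elim N)
    define D where "D = b / real N"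
    have D: "D > 0" using elim b by (simp add: D_def)
    define V where "V x = (\<Sum>k<nat \<lfloor>x / D\<rfloor>. u N k)" for x
    note rN = r[of N, folded D_def]
    have "(\<Sum>i\<in>{1..n}. phi c (f (s i) - f (t i)) - 2 * h) \<le> V b - V 0"
    proof (rule sum_interlaced_le[OF g])
      fix x y assume xy: "0 \<le> x" "x \<le> y" "y \<le> b"
      let ?x = "f (real (nat \<lfloor>x / D\<rfloor>) * D)" and ?y = "f (real (nat \<lfloor>y / D\<rfloor>) * D)"
      note P = phi_reflection_le(1)[OF rN floor_mesh_mono[OF xy(1,2) D]]
      have "N \<ge> 1" using elim by simp
      from P[OF this] have P: "phi c (?y - ?x) \<le> V y - V x" by (simp add: V_def)
      then show "V x \<le> V y" using phi_nonneg[of c "?y - ?x"] by linarith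
      have "\<bar>?x - f x\<bar> \<le> h" "\<bar>?y - f y\<bar> \<le> h" using elim xy by (auto simp: D_def)
      then show "phi c (f y - f x) - 2 * h \<le> V y - V x"
        using phi_le_add[of c "f y - f x" "?y - ?x"] P by linarith
    qed (use b in simp)
    moreover have "V 0 = 0" "V b = (\<Sum>k<N. u N k)"
      using elim b by (simp_all add: V_def D_def)
    moreover have "2 * h * real n \<le> e / 2" using e by (simp add: h_def field_simps)
    ultimately show ?case using S by (simp add: sum_subtractf algebra_simps)
  qed
qed

lemma TV_eventually_le_reflection:
  assumes cont: "continuous_on {0..b} f" and b: "b > 0" and c: "c > 0"
    and r: "\<And>N. N \<ge> 1 \<Longrightarrow> reflection c (\<lambda>k. f (real k * (b / real N))) (Y N) (u N) (l N)"
    and e: "e > 0"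
  shows "eventually (\<lambda>N. enn2real (TV c f 0 b) \<le> (\<Sum>k<N. u N k + l N k) + e) sequentially"
proof (cases "enn2real (TV c f 0 b) = 0")
  case True
  have "enn2real (TV c f 0 b) \<le> (\<Sum>k<N. u N k + l N k) + e" if "N \<ge> 1" for N
    using True e reflectionD(3,4)[OF r[OF that]] by (simp add: sum_nonneg add_nonneg_nonneg less_imp_le)
  then show ?thesis unfolding eventually_sequentially by blast
next
  case False
  have fin: "TV c f 0 b < \<top>" using TV_finite[OF c cont] b by simp
  let ?U = "enn2real (TV c f 0 b)"
  have U: "?U > 0" using False by (simp add: less_le)
  have "ennreal (?U - e / 2) < TV c f 0 b"
  proof -
    have "ennreal (?U - e / 2) < ennreal ?U" using U e by (intro ennreal_lessI) auto
    then show ?thesis using fin by simp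
  qed
  then obtain n t where g: "(n, t) \<in> grids 0 b"
    and less: "ennreal (?U - e / 2) < ennreal (\<Sum>i\<in>{1..<n}. phi c \<bar>f (t (Suc i)) - f (t i)\<bar>)"
    unfolding TV_def less_SUP_iff by auto
  have S: "?U - e / 2 < (\<Sum>i\<in>{1..<n}. phi c \<bar>f (t (Suc i)) - f (t i)\<bar>)"
  proof (rule ccontr)
    assume "\<not> ?thesis"
    then have "ennreal (\<Sum>i\<in>{1..<n}. phi c \<bar>f (t (Suc i)) - f (t i)\<bar>) \<le> ennreal (?U - e / 2)"
      by (intro ennreal_leI) simp
    with less show False by simp
  qed
  define h where "h = e / (4 * real (Suc n))"
  have h: "h > 0" using e by (simp add: h_def)
  from mesh_approx[OF cont b h] show ?thesis
  proof eventually_elim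
    case (elim N)
    define D where "D = b / real N"
    have D: "D > 0" using elim b by (simp add: D_def)
    define V where "V x = (\<Sum>k<nat \<lfloor>x / D\<rfloor>. u N k + l N k)" for x
    note rN = r[of N, folded D_def]
    have "(\<Sum>i\<in>{1..<n}. phi c \<bar>f (t (Suc i)) - f (t i)\<bar> - 2 * h) \<le> V b - V 0"
    proof (rule sum_grid_le[OF g])
      fix x y assume xy: "0 \<le> x" "x \<le> y" "y \<le> b"
      let ?x = "f (real (nat \<lfloor>x / D\<rfloor>) * D)" and ?y = "f (real (nat \<lfloor>y / D\<rfloor>) * D)"
      note P = phi_reflection_le(2)[OF rN floor_mesh_mono[OF xy(1,2) D]]
      have "N \<ge> 1" using elim by simp
      from P[OF this] have P: "phi c \<bar>?y - ?x\<bar> \<le> V y - V x" by (simp add: V_def)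
      then show "V x \<le> V y" using phi_nonneg[of c "\<bar>?y - ?x\<bar>"] by linarith
      have "\<bar>?x - f x\<bar> \<le> h" "\<bar>?y - f y\<bar> \<le> h" using elim xy by (auto simp: D_def)
      then have "\<bar>(f y - f x) - (?y - ?x)\<bar> \<le> 2 * h" by linarith
      with abs_triangle_ineq3[of "f y - f x" "?y - ?x"]
      have "\<bar>\<bar>f y - f x\<bar> - \<bar>?y - ?x\<bar>\<bar> \<le> 2 * h" by (rule order_trans)
      with phi_le_add[of c "\<bar>f y - f x\<bar>" "\<bar>?y - ?x\<bar>"]
      have "phi c \<bar>f y - f x\<bar> \<le> phi c \<bar>?y - ?x\<bar> + 2 * h" by (meson add_left_mono order_trans)
      with P show "phi c \<bar>f y - f x\<bar> - 2 * h \<le> V y - V x" by simp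
    qed (use b in simp)
    moreover have "V 0 = 0" "V b = (\<Sum>k<N. u N k + l N k)"
      using elim b by (simp_all add: V_def D_def)
    moreover have "2 * h * real (n - 1) \<le> 2 * h * real n" using h by (intro mult_left_mono) auto
    moreover have "2 * h * real n \<le> e / 2" using e by (simp add: h_def field_simps)
    ultimately show ?case using S by (simp add: sum_subtractf algebra_simps)
  qed
qed

text \<open>One reflection started at \<open>0\<close> serves all three quantities. For the negated path it starts at the
  upper barrier, which costs \<open>c\<close> in the lower bound for DTV.\<close>

lemma TV_UTV_DTV:
  assumes cont: "continuous_on {0..b} f" and b: "b > 0" and c: "c > 0"
  shows "\<bar>enn2real (TV c f 0 b) - (enn2real (UTV c f 0 b) + enn2real (DTV c f 0 b))\<bar> \<le> 2 * c"
proof -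
  have contm: "continuous_on {0..b} (\<lambda>x. - f x)" using cont by (intro continuous_intros)
  define x where "x N k = f (real (Suc k) * (b / real N)) - f (real k * (b / real N))" for N k
  define Y where "Y N = refl_path c (x N)" for N
  define u where "u N = push_down c (x N)" for N
  define l where "l N = push_up c (x N)" for N
  have r: "reflection c (\<lambda>k. f (real k * (b / real N))) (Y N) (u N) (l N)" for N
    unfolding Y_def u_def l_def by (rule reflection_refl_path[OF c]) (simp add: x_def)
  note rm = reflection_uminus[OF r]
  have Y0: "Y N 0 = 0" for N by (simp add: Y_def)
  let ?T = "enn2real (TV c f 0 b)" and ?U = "enn2real (UTV c f 0 b)" and ?D = "enn2real (DTV c f 0 b)"
  have le_enn2real: "v \<le> enn2real w" if "ennreal v \<le> w" "w < \<top>" for v w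
    using that by (metis enn2real_nonneg ennreal_enn2real ennreal_le_iff)
  have low: "(\<Sum>k<N. u N k) \<le> ?U" "(\<Sum>k<N. l N k) - c \<le> ?D" "(\<Sum>k<N. u N k + l N k) - 2 * c \<le> ?T"
    if "N \<ge> 1" for N
  proof -
    have d: "b / real N > 0" "real N * (b / real N) = b" using b that by simp_all
    show "(\<Sum>k<N. u N k) \<le> ?U"
      using le_enn2real[OF UTV_ge_reflection[OF c d(1) r, of N]] UTV_finite[OF c cont] b unfolding d Y0 by simp
    show "(\<Sum>k<N. l N k) - c \<le> ?D"
      using le_enn2real[OF UTV_ge_reflection[OF c d(1) rm, of N]] UTV_finite[OF c contm] b
      unfolding d Y0 DTV_eq_UTV by simp
    show "(\<Sum>k<N. u N k + l N k) - 2 * c \<le> ?T"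
      using le_enn2real[OF TV_ge_reflection[OF c d(1) r, of N]] TV_finite[OF c cont] b unfolding d by simp
  qed
  have up: "\<bar>?T - (?U + ?D)\<bar> \<le> 2 * c + 2 * e" if e: "e > 0" for e
  proof -
    have "eventually (\<lambda>N. \<bar>?T - (?U + ?D)\<bar> \<le> 2 * c + 2 * e) sequentially"
      using UTV_eventually_le_reflection[OF cont b c r e]
        UTV_eventually_le_reflection[OF contm b c rm e, folded DTV_eq_UTV]
        TV_eventually_le_reflection[OF cont b c r e] eventually_ge_at_top[of 1]
    proof eventually_elim
      case (elim N)
      note L = low[OF elim(4)]
      have "(\<Sum>k<N. u N k + l N k) = (\<Sum>k<N. u N k) + (\<Sum>k<N. l N k)" by (simp add: sum.distrib)
      then show ?case using elim L c e by linarith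
    qed
    then show ?thesis by simp
  qed
  show ?thesis
  proof (rule field_le_epsilon)
    fix e :: real assume "e > 0"
    then show "\<bar>?T - (?U + ?D)\<bar> \<le> 2 * c + e" using up[of "e / 2"] by simp
  qed
qed

section \<open>The corrector for reflected Brownian motion\<close>

text \<open>A solution \<open>h\<close> of \<open>h'' / 2 + \<mu> h' = \<kappa>\<close> on \<open>[0, c]\<close> with \<open>h' 0 = 0\<close> and \<open>h' c = 1\<close>: the left side
  is the generator of Brownian motion with drift \<open>\<mu>\<close>, and the boundary values make \<open>h\<close> insensitive
  to pushes at \<open>0\<close> and count pushes at \<open>c\<close> with weight one. Only the regularity that the estimates
  consume is recorded, with one constant \<open>K\<close>.\<close>

definition corrector ::
    "real \<Rightarrow> real \<Rightarrow> real \<Rightarrow> real \<Rightarrow> (real \<Rightarrow> real) \<Rightarrow> (real \<Rightarrow> real) \<Rightarrow> (real \<Rightarrow> real) \<Rightarrow> bool" where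
  "corrector c \<mu> \<kappa> K h g g' \<longleftrightarrow>
     (\<forall>a\<in>{0..c}. \<forall>b\<in>{0..c}.
        \<bar>h b - h a - g a * (b - a) - g' a / 2 * (b - a)\<^sup>2\<bar> \<le> K * \<bar>b - a\<bar> ^ 3 \<and>
        \<bar>g b - g a\<bar> \<le> K * \<bar>b - a\<bar>) \<and>
     (\<forall>a\<in>{0..c}. \<bar>h a\<bar> \<le> K \<and> \<bar>g a\<bar> \<le> K \<and> \<bar>g' a\<bar> \<le> K \<and> g' a / 2 + \<mu> * g a = \<kappa>) \<and>
     g 0 = 0 \<and> g c = 1"

lemma corrector_of_derivs:
  fixes h g g' g'' :: "real \<Rightarrow> real"
  assumes dh: "\<And>x. (h has_real_derivative g x) (at x)"
    and dg: "\<And>x. (g has_real_derivative g' x) (at x)"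
    and dg': "\<And>x. (g' has_real_derivative g'' x) (at x)"
    and cont: "continuous_on UNIV g''"
    and eq: "\<And>x. g' x / 2 + \<mu> * g x = \<kappa>" and bd: "g 0 = 0" "g c = 1"
  obtains K where "corrector c \<mu> \<kappa> K h g g'"
proof -
  have contd: "continuous_on {0..c} f" if "\<And>x. (f has_real_derivative f' x) (at x)" for f f'
    using that by (meson DERIV_isCont continuous_at_imp_continuous_on)
  obtain B0 where B0: "B0 \<ge> 0" "\<And>x. x \<in> {0..c} \<Longrightarrow> \<bar>h x\<bar> \<le> B0"
    using bounded_on_Icc[OF contd[OF dh]] by blast
  obtain B1 where B1: "B1 \<ge> 0" "\<And>x. x \<in> {0..c} \<Longrightarrow> \<bar>g x\<bar> \<le> B1"
    using bounded_on_Icc[OF contd[OF dg]] by blast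
  obtain B2 where B2: "B2 \<ge> 0" "\<And>x. x \<in> {0..c} \<Longrightarrow> \<bar>g' x\<bar> \<le> B2"
    using bounded_on_Icc[OF contd[OF dg']] by blast
  obtain B3 where B3: "B3 \<ge> 0" "\<And>x. x \<in> {0..c} \<Longrightarrow> \<bar>g'' x\<bar> \<le> B3"
    using bounded_on_Icc[OF continuous_on_subset[OF cont], of 0 c] by auto
  define K where "K = B0 + B1 + B2 + B3"
  have taylor: "\<bar>h b - h a - g a * (b - a) - g' a / 2 * (b - a)\<^sup>2\<bar> \<le> K * \<bar>b - a\<bar> ^ 3"
    if "a \<in> {0..c}" "b \<in> {0..c}" for a b
  proof (cases "a = b")
    case False
    define diff where "diff m = (if m = 0 then h else if m = 1 then g else if m = 2 then g' else g'')" for m :: nat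
    have "\<exists>t. (if b < a then b < t \<and> t < a else a < t \<and> t < b) \<and>
        h b = (\<Sum>m<3. diff m a / fact m * (b - a) ^ m) + diff 3 t / fact 3 * (b - a) ^ 3"
    proof (rule Taylor[of 3 diff h 0 c])
      show "\<forall>m t. m < 3 \<and> 0 \<le> t \<and> t \<le> c \<longrightarrow> (diff m has_real_derivative diff (Suc m) t) (at t)"
        using dh dg dg' by (auto simp: diff_def less_Suc_eq numeral_3_eq_3)
    qed (use that False in \<open>auto simp: diff_def\<close>)
    then obtain t where t: "if b < a then b < t \<and> t < a else a < t \<and> t < b"
      and "h b = (\<Sum>m<3. diff m a / fact m * (b - a) ^ m) + diff 3 t / fact 3 * (b - a) ^ 3" by blast
    then have "h b - h a - g a * (b - a) - g' a / 2 * (b - a)\<^sup>2 = g'' t / 6 * (b - a) ^ 3"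
      by (simp add: diff_def numeral_3_eq_3 lessThan_Suc power2_eq_square fact_numeral)
    also have "\<bar>\<dots>\<bar> = \<bar>g'' t\<bar> / 6 * \<bar>b - a\<bar> ^ 3" by (simp add: abs_mult power_abs)
    also have "\<dots> \<le> K * \<bar>b - a\<bar> ^ 3"
    proof (rule mult_right_mono)
      have "t \<in> {0..c}" using t that by (auto split: if_splits)
      then show "\<bar>g'' t\<bar> / 6 \<le> K" using B3(2)[of t] B0(1) B1(1) B2(1) B3(1) unfolding K_def by linarith
    qed simp
    finally show ?thesis .
  qed simp
  have lip: "\<bar>g b - g a\<bar> \<le> K * \<bar>b - a\<bar>" if "a \<in> {0..c}" "b \<in> {0..c}" for a b
  proof -
    have "norm (g b - g a) \<le> K * norm (b - a)"
    proof (rule field_differentiable_bound[where S = "{0..c}" and f' = g'])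
      show "(g has_field_derivative g' z) (at z within {0..c})" for z
        using dg by (rule has_field_derivative_at_within)
      show "norm (g' z) \<le> K" if "z \<in> {0..c}" for z
        using B2(2)[OF that] B0(1) B1(1) B3(1) by (simp add: K_def)
    qed (use that in auto)
    then show ?thesis by simp
  qed
  have "corrector c \<mu> \<kappa> K h g g'"
    unfolding corrector_def
  proof (intro conjI ballI)
    fix a assume a: "a \<in> {0..c}"
    show "\<bar>h a\<bar> \<le> K" "\<bar>g a\<bar> \<le> K" "\<bar>g' a\<bar> \<le> K"
      using B0 B1 B2 B3(1) a by (force simp: K_def)+
  qed (use taylor lip eq bd in auto)
  then show ?thesis using that by blast
qed

lemma n_const_nonzero:
  assumes "\<mu> \<noteq> 0" "c > 0"
  shows "1 / 2 * n_const c \<mu> = \<mu> / (1 - exp (- (2 * \<mu> * c)))"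
proof -
  define E where "E = exp (c * \<mu>)"
  have E: "E > 0" "E \<noteq> 1" using assms by (auto simp: E_def)
  then have "E\<^sup>2 \<noteq> 1" by (auto simp: power2_eq_1_iff)
  note E = E this
  have e1: "exp (- (2 * \<mu> * c)) = inverse (E\<^sup>2)"
    by (simp add: E_def exp_minus power2_eq_square mult_ac flip: exp_add)
  have c1: "coth (c * \<mu>) = (E + inverse E) / (E - inverse E)"
  proof -
    have "(a / 2) / (b / 2) = a / b" for a b :: real by simp
    then show ?thesis by (simp only: coth_def cosh_field_def sinh_field_def E_def exp_minus)
  qed
  have "E + inverse E = (E\<^sup>2 + 1) / E" "E - inverse E = (E\<^sup>2 - 1) / E"
    using E by (simp_all add: field_simps power2_eq_square)
  then have coth: "coth (c * \<mu>) = (E\<^sup>2 + 1) / (E\<^sup>2 - 1)" using c1 E by simp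
  have q: "1 - exp (- (2 * \<mu> * c)) = (E\<^sup>2 - 1) / E\<^sup>2" using e1 E by (simp add: field_simps)
  show ?thesis
    unfolding n_const_def coth q using assms E by (simp add: field_simps)
qed

text \<open>The equation is of first order in \<open>g = h'\<close>, so the two boundary values determine \<open>\<kappa>\<close>. This is
  where the constant of the theorem comes from.\<close>

lemma corrector_exists:
  assumes c: "c > 0"
  obtains K h g g' where "corrector c \<mu> (1 / 2 * n_const c \<mu>) K h g g'"
    "g \<in> borel_measurable borel" "g' \<in> borel_measurable borel"
proof (cases "\<mu> = 0")
  case True
  have "\<exists>K. corrector c \<mu> (1 / 2 * n_const c \<mu>) K (\<lambda>y. y\<^sup>2 / (2 * c)) (\<lambda>y. y / c) (\<lambda>y. 1 / c)"
    by (rule corrector_of_derivs[of "\<lambda>y. y\<^sup>2 / (2 * c)" "\<lambda>y. y / c" "\<lambda>y. 1 / c" "\<lambda>y. 0" \<mu> "1 / 2 * n_const c \<mu>" c])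
      (use c True in \<open>auto intro!: derivative_eq_intros simp: n_const_def\<close>)
  then show ?thesis using that by fastforce
next
  case False
  define q where "q = 1 - exp (- (2 * \<mu> * c))"
  have q: "q \<noteq> 0" using False c by (simp add: q_def)
  let ?h = "\<lambda>y. (y + exp (- (2 * \<mu> * y)) / (2 * \<mu>)) / q"
  let ?g = "\<lambda>y. (1 - exp (- (2 * \<mu> * y))) / q"
  let ?g' = "\<lambda>y. 2 * \<mu> * exp (- (2 * \<mu> * y)) / q"
  let ?g'' = "\<lambda>y. - (2 * \<mu>)\<^sup>2 * exp (- (2 * \<mu> * y)) / q"
  have "\<exists>K. corrector c \<mu> (1 / 2 * n_const c \<mu>) K ?h ?g ?g'"
  proof (rule corrector_of_derivs[of ?h ?g ?g' ?g'' \<mu> "1 / 2 * n_const c \<mu>" c])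
    fix x
    show "(?h has_real_derivative ?g x) (at x)"
      using False q by (auto intro!: derivative_eq_intros simp: field_simps)
    show "(?g has_real_derivative ?g' x) (at x)"
      using False q by (auto intro!: derivative_eq_intros simp: field_simps)
    show "(?g' has_real_derivative ?g'' x) (at x)"
      using False q by (auto intro!: derivative_eq_intros simp: field_simps power2_eq_square)
    show "?g' x / 2 + \<mu> * ?g x = 1 / 2 * n_const c \<mu>"
      unfolding n_const_nonzero[OF False c] q_def[symmetric] using q by (simp add: field_simps)
    show "continuous_on UNIV ?g''" using q by (auto intro!: continuous_intros)
    show "?g c = 1" using q by (simp add: q_def)
  qed auto
  then obtain K where "corrector c \<mu> (1 / 2 * n_const c \<mu>) K ?h ?g ?g'" by blast
  then show ?thesis using that[of K ?h ?g ?g'] by measurable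
qed

text \<open>Expand \<open>h\<close> to second order along \<open>Y' - Y = x - u + l\<close>. A push down occurs only if \<open>Y\<close> is within
  \<open>\<bar>x\<bar>\<close> of \<open>c\<close>, where \<open>g\<close> is within \<open>K \<bar>x\<bar>\<close> of \<open>1\<close>; a push up only near \<open>0\<close>, where \<open>g\<close> is that close to
  \<open>0\<close>. So the first-order effect of the pushes is \<open>-u\<close>, and that of the free increment is
  \<open>\<kappa> d\<close> plus centred terms because of the differential equation.\<close>

lemma corrector_step:
  fixes h g g' :: "real \<Rightarrow> real"
  assumes co: "corrector c \<mu> \<kappa> K h g g'" and r: "reflection c z Y u l" and c: "c > 0"
    and x: "z (Suc k) - z k = w + \<mu> * d" and d: "d \<ge> 0" and \<eta>: "\<bar>z (Suc k) - z k\<bar> \<le> \<eta>"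
  shows "\<bar>u k - \<kappa> * d - (g (Y k) * w + g' (Y k) / 2 * (w\<^sup>2 - d)) - (h (Y k) - h (Y (Suc k)))\<bar>
    \<le> K * \<eta> * (z (Suc k) - z k)\<^sup>2 + 3 * K * \<eta> * (u k + l k) + K * (\<bar>\<mu>\<bar> * d * (2 * \<eta> + \<bar>\<mu>\<bar> * d))"
proof -
  define x where "x = z (Suc k) - z k"
  define a where "a = Y k"
  define b where "b = Y (Suc k)"
  note R = reflectionD[OF r, of k, folded x_def a_def b_def]
  note xw = x[folded x_def] and \<eta>x = \<eta>[folded x_def]
  have ab: "a \<in> {0..c}" "b \<in> {0..c}"
    using reflectionD(1,2)[OF r] by (auto simp: a_def b_def)
  have c0: "0 \<in> {0..c}" "c \<in> {0..c}" using c by auto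
  have ul: "u k = 0 \<or> l k = 0" using R c by force
  have K: "K \<ge> 0" using co ab unfolding corrector_def by (meson abs_ge_zero order_trans)
  have ba: "b - a = x - u k + l k" using R by simp
  have ux: "u k \<le> \<bar>x\<bar>" "l k \<le> \<bar>x\<bar>" "\<bar>b - a\<bar> \<le> \<bar>x\<bar>" "u k > 0 \<Longrightarrow> \<bar>c - a\<bar> \<le> \<bar>x\<bar>" "l k > 0 \<Longrightarrow> \<bar>a\<bar> \<le> \<bar>x\<bar>"
  proof -
    consider "u k > 0" "l k = 0" | "l k > 0" "u k = 0" | "u k = 0" "l k = 0" using ul R by force
    then show "u k \<le> \<bar>x\<bar>" "l k \<le> \<bar>x\<bar>" "\<bar>b - a\<bar> \<le> \<bar>x\<bar>" "u k > 0 \<Longrightarrow> \<bar>c - a\<bar> \<le> \<bar>x\<bar>" "l k > 0 \<Longrightarrow> \<bar>a\<bar> \<le> \<bar>x\<bar>"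
      using R(6,7) ab ba by (cases; auto)+
  qed
  define e1 where "e1 = h b - h a - g a * (b - a) - g' a / 2 * (b - a)\<^sup>2"
  have E1: "\<bar>e1\<bar> \<le> K * \<eta> * x\<^sup>2"
  proof -
    have "\<bar>e1\<bar> \<le> K * \<bar>b - a\<bar> ^ 3" using co ab unfolding corrector_def e1_def by blast
    also have "\<dots> \<le> K * \<bar>x\<bar> ^ 3" using ux K by (intro mult_left_mono power_mono) auto
    also have "\<dots> = K * (\<bar>x\<bar> * x\<^sup>2)" by (simp add: power3_eq_cube power2_eq_square)
    also have "\<dots> \<le> K * (\<eta> * x\<^sup>2)" using \<eta>x K by (intro mult_left_mono mult_right_mono) auto
    finally show ?thesis by (simp add: mult_ac)
  qed
  have E2: "\<bar>(1 - g a) * u k\<bar> \<le> K * \<eta> * u k"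
  proof (cases "u k > 0")
    case True
    have "\<bar>g c - g a\<bar> \<le> K * \<bar>c - a\<bar>" "g c = 1"
      using co ab(1) c0(2) unfolding corrector_def by blast+
    then have "\<bar>1 - g a\<bar> \<le> K * \<bar>c - a\<bar>" by simp
    also have "\<dots> \<le> K * \<eta>" using K ux(4)[OF True] \<eta>x by (intro mult_left_mono) auto
    finally show ?thesis using True by (simp add: abs_mult)
  qed (use R in auto)
  have E3: "\<bar>g a * l k\<bar> \<le> K * \<eta> * l k"
  proof (cases "l k > 0")
    case True
    have "\<bar>g a - g 0\<bar> \<le> K * \<bar>a - 0\<bar>" using co ab(1) c0(1) unfolding corrector_def by blast
    also have "\<dots> \<le> K * \<eta>" using K ux(5)[OF True] \<eta>x by (intro mult_left_mono) auto
    finally show ?thesis using True co by (simp add: abs_mult corrector_def)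
  qed (use R in auto)
  have "\<bar>g' a\<bar> \<le> K" using co ab(1) unfolding corrector_def by blast
  then have g': "\<bar>g' a / 2\<bar> \<le> K / 2" by simp
  have E4: "\<bar>g' a / 2 * ((l k - u k) * (2 * x + l k - u k))\<bar> \<le> 3 / 2 * (K * \<eta> * (u k + l k))"
  proof -
    have "\<bar>l k - u k\<bar> \<le> u k + l k" "\<bar>2 * x + l k - u k\<bar> \<le> 3 * \<eta>"
      using R ux(1,2) ul \<eta>x by auto
    then have "\<bar>(l k - u k) * (2 * x + l k - u k)\<bar> \<le> (u k + l k) * (3 * \<eta>)"
      unfolding abs_mult using R by (intro mult_mono) auto
    then have "\<bar>g' a / 2 * ((l k - u k) * (2 * x + l k - u k))\<bar> \<le> K / 2 * ((u k + l k) * (3 * \<eta>))"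
      unfolding abs_mult[of "g' a / 2"] using g' K by (intro mult_mono) auto
    then show ?thesis by (simp add: algebra_simps)
  qed
  have E5: "\<bar>g' a / 2 * (x\<^sup>2 - w\<^sup>2)\<bar> \<le> 1 / 2 * (K * (\<bar>\<mu>\<bar> * d * (2 * \<eta> + \<bar>\<mu>\<bar> * d)))"
  proof -
    have "x\<^sup>2 - w\<^sup>2 = (\<mu> * d) * (2 * x - \<mu> * d)" using xw by (simp add: power2_eq_square algebra_simps)
    moreover have "\<bar>2 * x - \<mu> * d\<bar> \<le> 2 * \<eta> + \<bar>\<mu>\<bar> * d"
      using \<eta>x d abs_triangle_ineq4[of "2 * x" "\<mu> * d"] by (simp add: abs_mult)
    ultimately have "\<bar>x\<^sup>2 - w\<^sup>2\<bar> \<le> \<bar>\<mu>\<bar> * d * (2 * \<eta> + \<bar>\<mu>\<bar> * d)"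
      using d by (simp add: abs_mult mult_left_mono)
    then have "\<bar>g' a / 2 * (x\<^sup>2 - w\<^sup>2)\<bar> \<le> K / 2 * (\<bar>\<mu>\<bar> * d * (2 * \<eta> + \<bar>\<mu>\<bar> * d))"
      unfolding abs_mult[of "g' a / 2"] using g' K by (intro mult_mono) auto
    then show ?thesis by simp
  qed
  have "g' a / 2 + \<mu> * g a = \<kappa>" using co ab(1) unfolding corrector_def by blast
  note \<kappa> = this[symmetric]
  have "u k - \<kappa> * d - (g a * w + g' a / 2 * (w\<^sup>2 - d)) - (h a - h b) =
     e1 + (1 - g a) * u k + g a * l k + g' a / 2 * ((l k - u k) * (2 * x + l k - u k)) + g' a / 2 * (x\<^sup>2 - w\<^sup>2)"
  proof -
    have "u k - (q + \<mu> * g a) * d - (g a * w + q * (w\<^sup>2 - d)) - (h a - h b) =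
      h b - h a - g a * (x - u k + l k) - q * (x - u k + l k)\<^sup>2
      + (1 - g a) * u k + g a * l k + q * ((l k - u k) * (2 * x + l k - u k)) + q * (x\<^sup>2 - w\<^sup>2)" for q
      unfolding xw by (simp add: power2_eq_square algebra_simps)
    then show ?thesis unfolding e1_def ba \<kappa> .
  qed
  also have "\<bar>\<dots>\<bar> \<le> \<bar>e1\<bar> + \<bar>(1 - g a) * u k\<bar> + \<bar>g a * l k\<bar> +
      \<bar>g' a / 2 * ((l k - u k) * (2 * x + l k - u k))\<bar> + \<bar>g' a / 2 * (x\<^sup>2 - w\<^sup>2)\<bar>"
    by linarith
  also have "\<dots> \<le> K * \<eta> * x\<^sup>2 + K * \<eta> * u k + K * \<eta> * l k + 3 / 2 * (K * \<eta> * (u k + l k))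
      + 1 / 2 * (K * (\<bar>\<mu>\<bar> * d * (2 * \<eta> + \<bar>\<mu>\<bar> * d)))"
    using E1 E2 E3 E4 E5 by linarith
  also have "\<dots> \<le> K * \<eta> * x\<^sup>2 + 3 * K * \<eta> * (u k + l k) + K * (\<bar>\<mu>\<bar> * d * (2 * \<eta> + \<bar>\<mu>\<bar> * d))"
  proof -
    have "0 \<le> K * \<eta> * (u k + l k)" "0 \<le> K * (\<bar>\<mu>\<bar> * d * (2 * \<eta> + \<bar>\<mu>\<bar> * d))"
      using K R \<eta>x d by (auto intro!: mult_nonneg_nonneg add_nonneg_nonneg)
    then show ?thesis by (simp add: algebra_simps)
  qed
  finally show ?thesis unfolding a_def b_def x_def .
qed

text \<open>The errors contain the sum of the squared increments, which is turned into the elapsed time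
  plus a third martingale.\<close>

lemma corrector_sum:
  fixes h g g' :: "real \<Rightarrow> real"
  assumes co: "corrector c \<mu> \<kappa> K h g g'" and r: "reflection c z Y u l" and c: "c > 0"
    and x: "\<And>k. k < N \<Longrightarrow> z (Suc k) - z k = w k + \<mu> * d" and d: "d \<ge> 0"
    and \<eta>: "\<And>k. k < N \<Longrightarrow> \<bar>z (Suc k) - z k\<bar> \<le> \<eta>" "\<eta> \<ge> 0"
  shows "\<bar>(\<Sum>k<N. u k) - \<kappa> * (real N * d)\<bar>
    \<le> \<bar>\<Sum>k<N. g (Y k) * w k\<bar> + \<bar>\<Sum>k<N. g' (Y k) / 2 * ((w k)\<^sup>2 - d)\<bar> + 2 * K
      + K * \<eta> * (\<bar>\<Sum>k<N. (w k)\<^sup>2 - d\<bar> + real N * d + \<bar>\<mu>\<bar> * (real N * d) * (2 * \<eta> + \<bar>\<mu>\<bar> * d))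
      + 3 * K * \<eta> * (\<Sum>k<N. u k + l k) + K * (\<bar>\<mu>\<bar> * (real N * d) * (2 * \<eta> + \<bar>\<mu>\<bar> * d))"
proof -
  define \<rho> where "\<rho> = \<bar>\<mu>\<bar> * d * (2 * \<eta> + \<bar>\<mu>\<bar> * d)"
  define A where "A k = g (Y k) * w k + g' (Y k) / 2 * ((w k)\<^sup>2 - d)" for k
  have K: "K \<ge> 0" using co c unfolding corrector_def
    by (metis abs_ge_zero atLeastAtMost_iff less_imp_le order_refl order_trans)
  have hY: "\<bar>h (Y k)\<bar> \<le> K" for k
    using co reflectionD(1,2)[OF r, of k] unfolding corrector_def by auto
  have "\<bar>\<Sum>k<N. u k - \<kappa> * d - A k - (h (Y k) - h (Y (Suc k)))\<bar>
     \<le> (\<Sum>k<N. K * \<eta> * (z (Suc k) - z k)\<^sup>2 + 3 * K * \<eta> * (u k + l k) + K * \<rho>)"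
    unfolding A_def \<rho>_def
    by (intro order_trans[OF sum_abs] sum_mono corrector_step[OF co r c x d \<eta>(1)]) auto
  also have "\<dots> \<le> (\<Sum>k<N. K * \<eta> * (((w k)\<^sup>2 - d) + d + \<rho>) + 3 * K * \<eta> * (u k + l k) + K * \<rho>)"
  proof (rule sum_mono)
    fix k assume k: "k \<in> {..<N}"
    define y where "y = z (Suc k) - z k"
    have y: "y = w k + \<mu> * d" "\<bar>y\<bar> \<le> \<eta>" using x[of k] \<eta>(1)[of k] k by (auto simp: y_def)
    have "y\<^sup>2 - (w k)\<^sup>2 = (\<mu> * d) * (2 * y - \<mu> * d)" using y(1) by (simp add: power2_eq_square algebra_simps)
    also have "\<dots> \<le> \<bar>(\<mu> * d) * (2 * y - \<mu> * d)\<bar>" by simp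
    also have "\<dots> = \<bar>\<mu>\<bar> * d * \<bar>2 * y - \<mu> * d\<bar>" using d by (simp add: abs_mult)
    also have "\<dots> \<le> \<rho>" unfolding \<rho>_def
      using y(2) d abs_triangle_ineq4[of "2 * y" "\<mu> * d"] by (intro mult_left_mono) (auto simp: abs_mult)
    finally have "K * \<eta> * y\<^sup>2 \<le> K * \<eta> * (((w k)\<^sup>2 - d) + d + \<rho>)"
      using K \<eta>(2) by (intro mult_left_mono) auto
    then show "K * \<eta> * (z (Suc k) - z k)\<^sup>2 + 3 * K * \<eta> * (u k + l k) + K * \<rho> \<le>
      K * \<eta> * (((w k)\<^sup>2 - d) + d + \<rho>) + 3 * K * \<eta> * (u k + l k) + K * \<rho>" by (simp add: y_def)
  qed
  also have "\<dots> = K * \<eta> * ((\<Sum>k<N. (w k)\<^sup>2 - d) + real N * d + real N * \<rho>)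
      + 3 * K * \<eta> * (\<Sum>k<N. u k + l k) + K * (real N * \<rho>)"
  proof -
    have "(\<Sum>k<N. K * \<eta> * (B k + d + \<rho>) + 3 * K * \<eta> * C k + K * \<rho>) =
      K * \<eta> * ((\<Sum>k<N. B k) + real N * d + real N * \<rho>) + 3 * K * \<eta> * (\<Sum>k<N. C k) + K * (real N * \<rho>)" for B C
      by (simp add: sum.distrib sum_distrib_left[symmetric])
    then show ?thesis .
  qed
  also have "\<dots> \<le> K * \<eta> * (\<bar>\<Sum>k<N. (w k)\<^sup>2 - d\<bar> + real N * d + real N * \<rho>)
      + 3 * K * \<eta> * (\<Sum>k<N. u k + l k) + K * (real N * \<rho>)"
    using K \<eta>(2) by (intro add_mono mult_left_mono) auto
  finally have 1: "\<bar>\<Sum>k<N. u k - \<kappa> * d - A k - (h (Y k) - h (Y (Suc k)))\<bar> \<le> \<dots>" .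
  have "(\<Sum>k<N. h (Y k) - h (Y (Suc k))) = h (Y 0) - h (Y N)" by (rule sum_lessThan_telescope')
  then have 2: "(\<Sum>k<N. u k - \<kappa> * d - A k - (h (Y k) - h (Y (Suc k))))
      = (\<Sum>k<N. u k) - \<kappa> * (real N * d) - (\<Sum>k<N. A k) - (h (Y 0) - h (Y N))"
    by (simp add: sum_subtractf)
  have 3: "(\<Sum>k<N. A k) = (\<Sum>k<N. g (Y k) * w k) + (\<Sum>k<N. g' (Y k) / 2 * ((w k)\<^sup>2 - d))"
    unfolding A_def by (rule sum.distrib)
  have 4: "real N * \<rho> = \<bar>\<mu>\<bar> * (real N * d) * (2 * \<eta> + \<bar>\<mu>\<bar> * d)" by (simp add: \<rho>_def)
  have "\<bar>p\<bar> \<le> \<bar>s1\<bar> + \<bar>s2\<bar> + 2 * K + R"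
    if "\<bar>p - (s1 + s2) - (a - b)\<bar> \<le> R" "\<bar>a\<bar> \<le> K" "\<bar>b\<bar> \<le> K" for p s1 s2 a b R
    using that by linarith
  from this[OF 1[unfolded 2 3 4] hY hY] show ?thesis by (simp only: add.assoc)
qed

section \<open>A pathwise estimate for the upward truncated variation\<close>

lemma mesh_increment:
  fixes f :: "real \<Rightarrow> real"
  assumes "continuous_on {0..b} f" "b > 0" "e > 0"
  shows "eventually (\<lambda>N. N \<ge> 1 \<and> b / real N \<le> e \<and>
    (\<forall>k<N. \<bar>f (real (Suc k) * (b / real N)) - f (real k * (b / real N))\<bar> \<le> e)) sequentially"
proof -
  have "uniformly_continuous_on {0..b} f"
    using assms(1) by (intro compact_uniformly_continuous) auto
  then obtain d where d: "d > 0"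
    "\<And>x y. x \<in> {0..b} \<Longrightarrow> y \<in> {0..b} \<Longrightarrow> dist y x < d \<Longrightarrow> dist (f y) (f x) < e"
    unfolding uniformly_continuous_on_def using assms(3) by blast
  define d' where "d' = min d e"
  have d': "d' > 0" "d' \<le> d" "d' \<le> e" using d assms(3) by (auto simp: d'_def)
  obtain N0 where N0: "b / d' < real N0" using reals_Archimedean2 by blast
  show ?thesis
    unfolding eventually_sequentially
  proof (intro exI[of _ "Suc N0"] allI impI)
    fix N assume N: "Suc N0 \<le> N"
    define D where "D = b / real N"
    have "b / d' < real N" using N N0 by simp
    then have "b < real N * d'" using d' by (simp add: divide_less_eq)
    then have D: "D > 0" "D < d'" "real N * D = b"
      using N assms(2) by (auto simp: D_def divide_less_eq mult.commute)
    have "\<bar>f (real (Suc k) * D) - f (real k * D)\<bar> \<le> e" if "k < N" for k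
    proof -
      have "real (Suc k) * D \<le> real N * D" using that D by (intro mult_right_mono) auto
      then have "dist (f (real (Suc k) * D)) (f (real k * D)) < e"
        using D d' by (intro d(2)) (auto simp: dist_real_def algebra_simps)
      then show ?thesis by (simp add: dist_real_def)
    qed
    then show "N \<ge> 1 \<and> b / real N \<le> e \<and>
      (\<forall>k<N. \<bar>f (real (Suc k) * (b / real N)) - f (real k * (b / real N))\<bar> \<le> e)"
      using N D d' by (auto simp: D_def)
  qed
qed

text \<open>Along a subsequence of meshes all three martingales stay below \<open>sqrt R\<close>. The sum of all pushes
  is bounded by the finite TV of the path, and the increments tend to zero by
  continuity, so the error terms vanish along this subsequence.\<close>

lemma UTV_near_linear:
  fixes f :: "real \<Rightarrow> real" and w :: "nat \<Rightarrow> nat \<Rightarrow> real"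
  assumes co: "corrector c \<mu> \<kappa> K h g g'" and cont: "continuous_on {0..b} f" and b: "b > 0" and c: "c > 0"
    and w: "\<And>N k. f (real (Suc k) * (b / real N)) - f (real k * (b / real N)) = w N k + \<mu> * (b / real N)"
    and Y: "\<And>N k. Y N k = refl_path c (\<lambda>k. w N k + \<mu> * (b / real N)) k"
    and Q: "\<And>N. Q N = (\<Sum>k<N. g (Y N k) * w N k)\<^sup>2 +
      (\<Sum>k<N. g' (Y N k) / 2 * ((w N k)\<^sup>2 - b / real N))\<^sup>2 + (\<Sum>k<N. (w N k)\<^sup>2 - b / real N)\<^sup>2"
    and fin: "liminf (\<lambda>N. ennreal (Q N)) < \<top>"
  shows "\<bar>enn2real (UTV c f 0 b) - \<kappa> * b\<bar>
    \<le> 2 * sqrt (enn2real (liminf (\<lambda>N. ennreal (Q N))) + 1) + 2 * K + 2"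
proof -
  define R where "R = enn2real (liminf (\<lambda>N. ennreal (Q N))) + 1"
  have R: "R \<ge> 1" by (simp add: R_def)
  have freq: "\<exists>\<^sub>F N in sequentially. Q N \<le> R"
  proof (rule ccontr)
    assume "\<not> ?thesis"
    then have "\<forall>\<^sub>F N in sequentially. ennreal R \<le> ennreal (Q N)"
      unfolding not_frequently by eventually_elim (auto intro: ennreal_leI)
    then have "ennreal R \<le> liminf (\<lambda>N. ennreal (Q N))" by (rule Liminf_bounded)
    also have "\<dots> = ennreal (R - 1)" using fin by (simp add: R_def)
    finally show False using R by simp
  qed
  define d where "d N = b / real N" for N
  define x where "x N k = w N k + \<mu> * d N" for N k
  define u where "u N = push_down c (x N)" for N
  define l where "l N = push_up c (x N)" for N
  have r: "reflection c (\<lambda>k. f (real k * (b / real N))) (Y N) (u N) (l N)" for N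
  proof -
    have "x N = (\<lambda>k. w N k + \<mu> * (b / real N))" by (rule ext) (simp add: x_def d_def)
    then have "Y N = refl_path c (x N)" by (intro ext) (simp only: Y)
    then show ?thesis
      unfolding u_def l_def using w[of _ N] by (auto intro!: reflection_refl_path c simp: x_def d_def)
  qed
  have Y0: "Y N 0 = 0" for N by (simp add: Y)
  let ?U = "enn2real (UTV c f 0 b)" and ?T = "enn2real (TV c f 0 b)"
  have le_enn2real: "v \<le> enn2real w" if "ennreal v \<le> w" "w < \<top>" for v w
    using that by (metis enn2real_nonneg ennreal_enn2real ennreal_le_iff)
  have low: "(\<Sum>k<N. u N k) \<le> ?U" "(\<Sum>k<N. u N k + l N k) \<le> ?T + 2 * c"
    if "N \<ge> 1" for N
  proof -
    have d: "b / real N > 0" "real N * (b / real N) = b" using b that by simp_all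
    show "(\<Sum>k<N. u N k) \<le> ?U"
      using le_enn2real[OF UTV_ge_reflection[OF c d(1) r, of N]] UTV_finite[OF c cont] b unfolding d Y0 by simp
    show "(\<Sum>k<N. u N k + l N k) \<le> ?T + 2 * c"
      using le_enn2real[OF TV_ge_reflection[OF c d(1) r, of N]] TV_finite[OF c cont] b unfolding d by simp
  qed
  have K: "K \<ge> 0" using co c unfolding corrector_def
    by (metis abs_ge_zero atLeastAtMost_iff less_imp_le order_refl order_trans)
  \<comment> \<open>The error of \<open>corrector_sum\<close> when increments and mesh are at most \<open>e\<close>.\<close>
  define err where "err e = K * e * (sqrt R + b + \<bar>\<mu>\<bar> * b * (2 * e + \<bar>\<mu>\<bar> * e))
      + 3 * K * e * (?T + 2 * c) + K * (\<bar>\<mu>\<bar> * b * (2 * e + \<bar>\<mu>\<bar> * e))" for e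
  have "(err \<longlongrightarrow> err 0) (at_right 0)"
    unfolding err_def by (intro tendsto_intros)
  then have "\<forall>\<^sub>F e in at_right 0. err e < 1"
    by (rule order_tendstoD) (simp add: err_def)
  moreover have "\<forall>\<^sub>F e in at_right (0::real). e > 0" by (simp add: eventually_at_right_less)
  ultimately have "\<forall>\<^sub>F e in at_right 0. err e < 1 \<and> e > 0" by (rule eventually_conj)
  then obtain e where e: "err e < 1" "e > 0"
    using eventually_happens[of _ "at_right (0::real)"] trivial_limit_at_right_real by blast
  have "\<exists>\<^sub>F N in sequentially. \<bar>(\<Sum>k<N. u N k) - \<kappa> * b\<bar> \<le> 2 * sqrt R + 2 * K + 1 \<and> N \<ge> 1"
    using frequently_eventually_frequently[OF freq mesh_increment[OF cont b e(2)]]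
  proof (rule frequently_elim1)
    fix N assume "Q N \<le> R \<and> N \<ge> 1 \<and> b / real N \<le> e \<and>
      (\<forall>k<N. \<bar>f (real (Suc k) * (b / real N)) - f (real k * (b / real N))\<bar> \<le> e)"
    then have N: "Q N \<le> R" "N \<ge> 1" "d N \<le> e"
      "\<And>k. k < N \<Longrightarrow> \<bar>f (real (Suc k) * (b / real N)) - f (real k * (b / real N))\<bar> \<le> e"
      by (auto simp: d_def)
    have dN: "d N > 0" "real N * d N = b" using b N by (auto simp: d_def)
    define S1 where "S1 = (\<Sum>k<N. g (Y N k) * w N k)"
    define S2 where "S2 = (\<Sum>k<N. g' (Y N k) / 2 * ((w N k)\<^sup>2 - d N))"
    define S3 where "S3 = (\<Sum>k<N. (w N k)\<^sup>2 - d N)"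
    have QS: "S1\<^sup>2 + S2\<^sup>2 + S3\<^sup>2 \<le> R" using N(1) by (simp add: Q S1_def S2_def S3_def d_def)
    have "S1\<^sup>2 \<le> R" "S2\<^sup>2 \<le> R" "S3\<^sup>2 \<le> R"
      using QS zero_le_power2[of S1] zero_le_power2[of S2] zero_le_power2[of S3] by linarith+
    then have S: "\<bar>S1\<bar> \<le> sqrt R" "\<bar>S2\<bar> \<le> sqrt R" "\<bar>S3\<bar> \<le> sqrt R"
      by (auto intro!: real_le_rsqrt)
    have "\<bar>(\<Sum>k<N. u N k) - \<kappa> * (real N * d N)\<bar> \<le> \<bar>S1\<bar> + \<bar>S2\<bar> + 2 * K
      + K * e * (\<bar>S3\<bar> + real N * d N + \<bar>\<mu>\<bar> * (real N * d N) * (2 * e + \<bar>\<mu>\<bar> * d N))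
      + 3 * K * e * (\<Sum>k<N. u N k + l N k) + K * (\<bar>\<mu>\<bar> * (real N * d N) * (2 * e + \<bar>\<mu>\<bar> * d N))"
      unfolding S1_def S2_def S3_def
      by (rule corrector_sum[OF co r c]) (use w N(4) dN e in \<open>auto simp: d_def\<close>)
    also have "\<dots> \<le> sqrt R + sqrt R + 2 * K
      + K * e * (sqrt R + b + \<bar>\<mu>\<bar> * b * (2 * e + \<bar>\<mu>\<bar> * e))
      + 3 * K * e * (?T + 2 * c) + K * (\<bar>\<mu>\<bar> * b * (2 * e + \<bar>\<mu>\<bar> * e))"
      unfolding dN(2) using S K e b N(3) low(2)[OF N(2)]
      by (intro add_mono mult_left_mono order_refl) (auto intro!: mult_nonneg_nonneg)
    also have "\<dots> = 2 * sqrt R + 2 * K + err e" by (simp add: err_def)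
    finally have "\<bar>(\<Sum>k<N. u N k) - \<kappa> * b\<bar> \<le> 2 * sqrt R + 2 * K + err e" unfolding dN(2) .
    with e(1) show "\<bar>(\<Sum>k<N. u N k) - \<kappa> * b\<bar> \<le> 2 * sqrt R + 2 * K + 1 \<and> N \<ge> 1"
      using N(2) by linarith
  qed
  moreover have "\<forall>\<^sub>F N in sequentially. ?U \<le> (\<Sum>k<N. u N k) + 1"
    by (rule UTV_eventually_le_reflection[OF cont b c r]) simp
  ultimately have "\<exists>\<^sub>F N in sequentially. (\<bar>(\<Sum>k<N. u N k) - \<kappa> * b\<bar> \<le> 2 * sqrt R + 2 * K + 1 \<and> N \<ge> 1)
      \<and> ?U \<le> (\<Sum>k<N. u N k) + 1"
    by (rule frequently_eventually_frequently)
  then obtain N where N: "\<bar>(\<Sum>k<N. u N k) - \<kappa> * b\<bar> \<le> 2 * sqrt R + 2 * K + 1" "N \<ge> 1"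
      "?U \<le> (\<Sum>k<N. u N k) + 1"
    using frequently_ex by blast
  show ?thesis using N(1,3) low(1)[OF N(2)] unfolding R_def by linarith
qed

section \<open>Discrete martingale transforms\<close>

text \<open>Orthogonality of martingale increments: \<open>A k\<close> and the partial sum depend on the first \<open>k\<close>
  variables only, hence are independent of the centred \<open>F (w k)\<close>.\<close>

lemma (in prob_space) predictable_transform_L2:
  fixes w :: "nat \<Rightarrow> 'a \<Rightarrow> real" and A :: "nat \<Rightarrow> (nat \<Rightarrow> real) \<Rightarrow> real"
  assumes ind: "indep_vars (\<lambda>_. borel) w {..<N}"
    and F [measurable]: "F \<in> borel_measurable borel"
    and int: "\<And>k. k < N \<Longrightarrow> integrable M (\<lambda>\<omega>. (F (w k \<omega>))\<^sup>2)"
    and mean: "\<And>k. k < N \<Longrightarrow> expectation (\<lambda>\<omega>. F (w k \<omega>)) = 0"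
    and var: "\<And>k. k < N \<Longrightarrow> expectation (\<lambda>\<omega>. (F (w k \<omega>))\<^sup>2) \<le> v"
    and A: "\<And>k. k < N \<Longrightarrow> A k \<in> borel_measurable (PiM {..<k} (\<lambda>_. borel))"
    and K: "\<And>k x. k < N \<Longrightarrow> \<bar>A k x\<bar> \<le> K"
  defines "S \<equiv> \<lambda>n \<omega>. \<Sum>k<n. A k (restrict (\<lambda>i. w i \<omega>) {..<k}) * F (w k \<omega>)"
  assumes "n \<le> N"
  shows "integrable M (\<lambda>\<omega>. (S n \<omega>)\<^sup>2) \<and> expectation (\<lambda>\<omega>. (S n \<omega>)\<^sup>2) \<le> real n * (K\<^sup>2 * v)"
  using \<open>n \<le> N\<close>
proof (induction n)
  case 0
  then show ?case by (simp add: S_def)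
next
  case (Suc n)
  then have n: "n < N" and IH: "integrable M (\<lambda>\<omega>. (S n \<omega>)\<^sup>2)"
      "expectation (\<lambda>\<omega>. (S n \<omega>)\<^sup>2) \<le> real n * (K\<^sup>2 * v)" by auto
  have w [measurable]: "w k \<in> borel_measurable M" if "k < N" for k
    using ind that by (auto simp: indep_vars_def)
  define G where "G x = (\<Sum>k<n. A k (restrict x {..<k}) * F (x k))" for x :: "nat \<Rightarrow> real"
  let ?r = "\<lambda>\<omega>. restrict (\<lambda>i. w i \<omega>) {..<n}"
  have r: "?r \<in> measurable M (PiM {..<n} (\<lambda>_. borel))"
    using n by (intro measurable_restrict) auto
  have G: "G \<in> borel_measurable (PiM {..<n} (\<lambda>_. borel))"
    unfolding G_def
  proof (intro borel_measurable_sum borel_measurable_times)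
    fix k assume k: "k \<in> {..<n}"
    then have kN: "k < N" using n by simp
    show "(\<lambda>x. A k (restrict x {..<k})) \<in> borel_measurable (PiM {..<n} (\<lambda>_. borel))"
      by (rule measurable_compose[OF measurable_restrict_subset A[OF kN]]) (use k in auto)
    show "(\<lambda>x. F (x k)) \<in> borel_measurable (PiM {..<n} (\<lambda>_. borel))"
      by (rule measurable_compose[OF measurable_component_singleton[of k "{..<n}" "\<lambda>_. borel"] F]) (use k in auto)
  qed
  have SG: "S n \<omega> = G (?r \<omega>)" for \<omega>
    unfolding S_def G_def by (intro sum.cong refl) (simp add: Int_absorb1)
  have Sm [measurable]: "S n \<in> borel_measurable M"
    using measurable_compose[OF r G] unfolding SG .
  have Am [measurable]: "(\<lambda>\<omega>. A n (?r \<omega>)) \<in> borel_measurable M"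
    using measurable_compose[OF r A[OF n]] .
  have wn [measurable]: "w n \<in> borel_measurable M" using w[OF n] .
  have ivar: "indep_var borel (\<lambda>\<omega>. S n \<omega> * A n (?r \<omega>)) borel (\<lambda>\<omega>. F (w n \<omega>))"
  proof -
    have "indep_var borel ((\<lambda>x. G x * A n x) \<circ> ?r) borel ((\<lambda>x. F (x n)) \<circ> (\<lambda>\<omega>. restrict (\<lambda>i. w i \<omega>) {n}))"
      using n G A[OF n]
      by (intro indep_var_compose[OF indep_var_restrict[OF ind]] borel_measurable_times
          measurable_compose[OF measurable_component_singleton[of n "{n}" "\<lambda>_. borel"] F]) auto
    then show ?thesis by (simp add: comp_def SG)
  qed
  have Sint: "integrable M (S n)"
    by (rule square_integrable_imp_integrable[OF Sm IH(1)])
  have Fint: "integrable M (\<lambda>\<omega>. F (w n \<omega>))"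
    by (rule square_integrable_imp_integrable[OF _ int[OF n]]) measurable
  have SAint: "integrable M (\<lambda>\<omega>. S n \<omega> * A n (?r \<omega>))"
  proof (rule Bochner_Integration.integrable_bound)
    show "integrable M (\<lambda>\<omega>. K * S n \<omega>)" using Sint by simp
    have "\<bar>A n x\<bar> \<le> \<bar>K\<bar>" for x using K[OF n, of x] by linarith
    then show "AE \<omega> in M. norm (S n \<omega> * A n (?r \<omega>)) \<le> norm (K * S n \<omega>)"
      by (intro AE_I2) (simp add: abs_mult mult.commute[of "\<bar>K\<bar>"] mult_left_mono)
  qed measurable
  have cross: "integrable M (\<lambda>\<omega>. S n \<omega> * A n (?r \<omega>) * F (w n \<omega>))"
    "expectation (\<lambda>\<omega>. S n \<omega> * A n (?r \<omega>) * F (w n \<omega>)) = 0"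
    using indep_var_integrable[OF ivar SAint Fint] indep_var_lebesgue_integral[OF ivar SAint Fint] mean[OF n]
    by auto
  have sq: "(A n (?r \<omega>))\<^sup>2 * (F (w n \<omega>))\<^sup>2 \<le> K\<^sup>2 * (F (w n \<omega>))\<^sup>2" for \<omega>
    using K[OF n, of "?r \<omega>"] by (intro mult_right_mono) (auto simp: abs_le_square_iff[symmetric])
  have AFint: "integrable M (\<lambda>\<omega>. (A n (?r \<omega>))\<^sup>2 * (F (w n \<omega>))\<^sup>2)"
  proof (rule Bochner_Integration.integrable_bound)
    show "integrable M (\<lambda>\<omega>. K\<^sup>2 * (F (w n \<omega>))\<^sup>2)" using int[OF n] by simp
    show "AE \<omega> in M. norm ((A n (?r \<omega>))\<^sup>2 * (F (w n \<omega>))\<^sup>2) \<le> norm (K\<^sup>2 * (F (w n \<omega>))\<^sup>2)"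
      using sq by auto
  qed measurable
  have "expectation (\<lambda>\<omega>. (A n (?r \<omega>))\<^sup>2 * (F (w n \<omega>))\<^sup>2) \<le> expectation (\<lambda>\<omega>. K\<^sup>2 * (F (w n \<omega>))\<^sup>2)"
    using int[OF n] by (intro integral_mono AFint sq) simp
  also have "\<dots> \<le> K\<^sup>2 * v" using var[OF n] by (simp add: mult_left_mono)
  finally have AFle: "expectation (\<lambda>\<omega>. (A n (?r \<omega>))\<^sup>2 * (F (w n \<omega>))\<^sup>2) \<le> K\<^sup>2 * v" .
  have eq: "(S (Suc n) \<omega>)\<^sup>2 = (S n \<omega>)\<^sup>2 + 2 * (S n \<omega> * A n (?r \<omega>) * F (w n \<omega>))
      + (A n (?r \<omega>))\<^sup>2 * (F (w n \<omega>))\<^sup>2" for \<omega>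
    by (simp add: S_def power2_eq_square algebra_simps)
  show ?case
    unfolding eq using IH cross AFint AFle
    by (simp add: algebra_simps)
qed

lemma (in prob_space) centered_normal_moments:
  assumes X: "distributed M lborel X (normal_density 0 \<sigma>)" and \<sigma>: "\<sigma> > 0"
  shows "integrable M (\<lambda>\<omega>. X \<omega> ^ n)" "expectation X = 0" "expectation (\<lambda>\<omega>. (X \<omega>)\<^sup>2) = \<sigma>\<^sup>2"
    "expectation (\<lambda>\<omega>. X \<omega> ^ 4) = 3 * \<sigma> ^ 4"
proof -
  have D: "expectation (\<lambda>\<omega>. X \<omega> ^ k) = (\<integral>x. normal_density 0 \<sigma> x * x ^ k \<partial>lborel)" for k
    using distributed_integral[OF X, of "\<lambda>x. x ^ k"] by simp
  show "integrable M (\<lambda>\<omega>. X \<omega> ^ n)"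
    using distributed_integrable[OF X, of "\<lambda>x. x ^ n"] integrable_normal_moment[OF \<sigma>, of 0 n] by simp
  show "expectation X = 0" by (rule normal_distributed_expectation[OF \<sigma> X])
  show "expectation (\<lambda>\<omega>. (X \<omega>)\<^sup>2) = \<sigma>\<^sup>2"
    using D[of 2] integral_normal_moment_even[OF \<sigma>, of 0 1] \<sigma> by simp
  have "fact (2 * 2) / ((2 / \<sigma>\<^sup>2)\<^sup>2 * fact 2) = 3 * \<sigma> ^ 4"
    using \<sigma> by (simp add: fact_numeral power_divide flip: power_mult)
  then show "expectation (\<lambda>\<omega>. X \<omega> ^ 4) = 3 * \<sigma> ^ 4"
    using D[of 4] integral_normal_moment_even[OF \<sigma>, of 0 2] by simp
qed

lemma refl_path_cong: "(\<And>i. i < k \<Longrightarrow> x i = x' i) \<Longrightarrow> refl_path c x k = refl_path c x' k"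
  by (induction k) auto

lemma refl_path_measurable:
  "k \<le> n \<Longrightarrow> (\<lambda>x. refl_path c (\<lambda>i. x i + e) k) \<in> borel_measurable (PiM {..<n} (\<lambda>_. borel))"
proof (induction k)
  case (Suc k)
  then have [measurable]: "(\<lambda>x. refl_path c (\<lambda>i. x i + e) k) \<in> borel_measurable (PiM {..<n} (\<lambda>_. borel))"
    by simp
  have [measurable]: "(\<lambda>x. x k) \<in> borel_measurable (PiM {..<n} (\<lambda>_. borel))"
    using Suc by (intro measurable_component_singleton) auto
  show ?case by simp
qed simp

section \<open>The limit along square times\<close>

context standard_brownian_motion
begin

lemma increments:
  assumes d: "d > 0"
  defines "w \<equiv> \<lambda>k \<omega>. W (real (Suc k) * d) \<omega> - W (real k * d) \<omega>"
  shows "indep_vars (\<lambda>_. borel) w {..<N}"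
    and "distributed M lborel (w k) (normal_density 0 (sqrt d))"
proof -
  show "indep_vars (\<lambda>_. borel) w {..<N}"
    unfolding w_def using d by (intro indep_increments[of "\<lambda>i. real i * d"]) (auto intro!: strict_mono_onI)
  have "real (Suc k) * d - real k * d = d" by (simp add: algebra_simps)
  then show "distributed M lborel (w k) (normal_density 0 (sqrt d))"
    using gaussian_increments[of "real k * d" "real (Suc k) * d"] d unfolding w_def by simp
qed

text \<open>The parameter \<open>e\<close> is the drift per step. The corrector enters only through bounds on its
  derivatives, since \<open>Y\<close> never leaves \<open>[0, c]\<close>.\<close>

lemma corrector_martingales_L2:
  fixes g g' :: "real \<Rightarrow> real" and c d e K :: real and N :: nat
  assumes d: "d > 0" and c: "c > 0"
    and meas: "g \<in> borel_measurable borel" "g' \<in> borel_measurable borel"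
    and bd: "\<And>y. y \<in> {0..c} \<Longrightarrow> \<bar>g y\<bar> \<le> K" "\<And>y. y \<in> {0..c} \<Longrightarrow> \<bar>g' y\<bar> \<le> K"
  defines "w \<equiv> \<lambda>k \<omega>. W (real (Suc k) * d) \<omega> - W (real k * d) \<omega>"
  defines "Y \<equiv> \<lambda>k \<omega>. refl_path c (\<lambda>k. w k \<omega> + e) k"
  defines "Q \<equiv> \<lambda>\<omega>. (\<Sum>k<N. g (Y k \<omega>) * w k \<omega>)\<^sup>2 + (\<Sum>k<N. g' (Y k \<omega>) / 2 * ((w k \<omega>)\<^sup>2 - d))\<^sup>2
      + (\<Sum>k<N. (w k \<omega>)\<^sup>2 - d)\<^sup>2"
  shows "integrable M Q" and "expectation Q \<le> real N * (K\<^sup>2 * d) + real N * (K\<^sup>2 * (2 * d\<^sup>2)) + real N * (2 * d\<^sup>2)"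
proof -
  have ind: "indep_vars (\<lambda>_. borel) w {..<N}" unfolding w_def by (rule increments(1)[OF d])
  have dist: "distributed M lborel (w k) (normal_density 0 (sqrt d))" for k
    unfolding w_def by (rule increments(2)[OF d])
  have sd: "sqrt d > 0" using d by simp
  note mom = centered_normal_moments[OF dist sd]
  have sd4: "sqrt d ^ 4 = d\<^sup>2" using d by (simp add: power4_eq_xxxx power2_eq_square)
  have F2: "((w k \<omega>)\<^sup>2 - d)\<^sup>2 = w k \<omega> ^ 4 - 2 * d * (w k \<omega>)\<^sup>2 + d\<^sup>2" for k \<omega>
    by (simp add: power2_eq_square power4_eq_xxxx algebra_simps)
  have F2int: "integrable M (\<lambda>\<omega>. ((w k \<omega>)\<^sup>2 - d)\<^sup>2)" for k
    unfolding F2 using mom(1) by (intro Bochner_Integration.integrable_add Bochner_Integration.integrable_diff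
        integrable_mult_right) auto
  have Fmean: "expectation (\<lambda>\<omega>. (w k \<omega>)\<^sup>2 - d) = 0" for k
    using mom(1)[of k 2] mom(3)[of k] d by (simp add: prob_space)
  have Fvar: "expectation (\<lambda>\<omega>. ((w k \<omega>)\<^sup>2 - d)\<^sup>2) = 2 * d\<^sup>2" for k
    unfolding F2 using mom(1)[of k 2] mom(1)[of k 4] mom(3,4)[of k] d sd4
    by (simp add: prob_space power2_eq_square)
  have refl_mem: "refl_path c x k \<in> {0..c}" for x k using refl_path_bounds[OF c, of x k] by simp
  have Yr: "refl_path c (\<lambda>i. restrict (\<lambda>i. w i \<omega>) {..<k} i + e) k = Y k \<omega>" for k \<omega>
    unfolding Y_def by (rule refl_path_cong) simp
  have K: "K \<ge> 0" using bd(1)[of 0] c by (auto intro: order_trans[OF abs_ge_zero])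
  note rm = refl_path_measurable[OF order_refl]
  have 1: "integrable M (\<lambda>\<omega>. (\<Sum>k<N. g (Y k \<omega>) * w k \<omega>)\<^sup>2) \<and>
      expectation (\<lambda>\<omega>. (\<Sum>k<N. g (Y k \<omega>) * w k \<omega>)\<^sup>2) \<le> real N * (K\<^sup>2 * d)"
    using predictable_transform_L2[OF ind, of "\<lambda>x. x" d "\<lambda>k x. g (refl_path c (\<lambda>i. x i + e) k)" K N]
      mom(1)[of _ 2] mom(2,3) d bd(1)[OF refl_mem] measurable_compose[OF rm meas(1)]
    unfolding Yr by simp
  have 2: "integrable M (\<lambda>\<omega>. (\<Sum>k<N. g' (Y k \<omega>) / 2 * ((w k \<omega>)\<^sup>2 - d))\<^sup>2) \<and>
      expectation (\<lambda>\<omega>. (\<Sum>k<N. g' (Y k \<omega>) / 2 * ((w k \<omega>)\<^sup>2 - d))\<^sup>2) \<le> real N * (K\<^sup>2 * (2 * d\<^sup>2))"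
  proof -
    have "\<bar>g' (refl_path c x k) / 2\<bar> \<le> K" for x k using bd(2)[OF refl_mem, of x k] K by simp
    moreover have "(\<lambda>x. g' (refl_path c (\<lambda>i. x i + e) k) / 2) \<in> borel_measurable (PiM {..<k} (\<lambda>_. borel))" for k
      using measurable_compose[OF rm meas(2)] by (intro borel_measurable_divide) auto
    ultimately show ?thesis
      using predictable_transform_L2[OF ind, of "\<lambda>x. x\<^sup>2 - d" "2 * d\<^sup>2"
          "\<lambda>k x. g' (refl_path c (\<lambda>i. x i + e) k) / 2" K N] F2int Fmean Fvar
      unfolding Yr by simp
  qed
  have 3: "integrable M (\<lambda>\<omega>. (\<Sum>k<N. (w k \<omega>)\<^sup>2 - d)\<^sup>2) \<and>
      expectation (\<lambda>\<omega>. (\<Sum>k<N. (w k \<omega>)\<^sup>2 - d)\<^sup>2) \<le> real N * (2 * d\<^sup>2)"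
    using predictable_transform_L2[OF ind, of "\<lambda>x. x\<^sup>2 - d" "2 * d\<^sup>2" "\<lambda>k x. 1" 1 N] F2int Fmean Fvar
    by simp
  show "integrable M Q" unfolding Q_def using 1 2 3 by simp
  show "expectation Q \<le> real N * (K\<^sup>2 * d) + real N * (K\<^sup>2 * (2 * d\<^sup>2)) + real N * (2 * d\<^sup>2)"
    unfolding Q_def using 1 2 3 by simp
qed

text \<open>The random bound of \<open>UTV_near_linear\<close> is controlled by \<open>\<rho> b\<close>, the lower limit over the meshes
  of the sum of squared martingales. Fatou's lemma gives it mean at most \<open>C b\<close>, so
  \<open>\<rho> (k\<^sup>2) / k\<^sup>4\<close> is summable in mean, hence almost surely, and in particular tends to zero. Working
  with \<open>\<rho>\<close> also avoids the measurability of UTV itself.\<close>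

lemma AE_UTV_squares:
  assumes c: "c > 0"
  shows "AE \<omega> in M. (\<lambda>k. enn2real (UTV c (\<lambda>u. W u \<omega> + \<mu> * u) 0 ((real k)\<^sup>2)) / (real k)\<^sup>2)
    \<longlonglongrightarrow> 1 / 2 * n_const c \<mu>"
proof -
  define \<kappa> where "\<kappa> = 1 / 2 * n_const c \<mu>"
  obtain K h g g' where co: "corrector c \<mu> \<kappa> K h g g'"
    and meas: "g \<in> borel_measurable borel" "g' \<in> borel_measurable borel"
    using corrector_exists[OF c] unfolding \<kappa>_def by blast
  have bd: "\<bar>g y\<bar> \<le> K" "\<bar>g' y\<bar> \<le> K" if "y \<in> {0..c}" for y
    using co that unfolding corrector_def by blast+
  define w where "w b N k \<omega> = W (real (Suc k) * (b / real N)) \<omega> - W (real k * (b / real N)) \<omega>" for b N k \<omega>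
  define Y where "Y b N k \<omega> = refl_path c (\<lambda>k. w b N k \<omega> + \<mu> * (b / real N)) k" for b N k \<omega>
  define Q where "Q b N \<omega> = (\<Sum>k<N. g (Y b N k \<omega>) * w b N k \<omega>)\<^sup>2 +
      (\<Sum>k<N. g' (Y b N k \<omega>) / 2 * ((w b N k \<omega>)\<^sup>2 - b / real N))\<^sup>2 + (\<Sum>k<N. (w b N k \<omega>)\<^sup>2 - b / real N)\<^sup>2" for b N \<omega>
  define \<rho> where "\<rho> b \<omega> = liminf (\<lambda>N. ennreal (Q b N \<omega>))" for b \<omega>
  define C where "C = 3 * K\<^sup>2 + 2"
  have Qpos: "0 \<le> Q b N \<omega>" for b N \<omega> by (simp add: Q_def)
  have QL2: "integrable M (Q b N)"
    "expectation (Q b N) \<le> real N * (K\<^sup>2 * (b / real N)) + real N * (K\<^sup>2 * (2 * (b / real N)\<^sup>2)) + real N * (2 * (b / real N)\<^sup>2)"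
    if "b > 0" "N \<ge> 1" for b N
  proof -
    have d: "b / real N > 0" using that by simp
    note L = corrector_martingales_L2[OF d c meas bd, where N = N and e = "\<mu> * (b / real N)"]
    show "integrable M (Q b N)"
      using L(1) unfolding Q_def[abs_def] Y_def w_def by simp
    show "expectation (Q b N) \<le> real N * (K\<^sup>2 * (b / real N)) + real N * (K\<^sup>2 * (2 * (b / real N)\<^sup>2)) + real N * (2 * (b / real N)\<^sup>2)"
      using L(2) unfolding Q_def[abs_def] Y_def w_def by simp
  qed
  have Qm: "(\<lambda>\<omega>. ennreal (Q b N \<omega>)) \<in> borel_measurable M" if "b > 0" for b N
  proof (cases "N \<ge> 1")
    case True
    then show ?thesis using borel_measurable_integrable[OF QL2(1)[OF that True]] by simp
  next
    case False
    then have "N = 0" by simp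
    then show ?thesis by (simp add: Q_def)
  qed
  have \<rho>m: "\<rho> b \<in> borel_measurable M" if "b > 0" for b
    unfolding \<rho>_def[abs_def] using Qm[OF that] by (intro borel_measurable_liminf)
  have \<rho>int: "(\<integral>\<^sup>+\<omega>. \<rho> b \<omega> \<partial>M) \<le> ennreal (C * b)" if b: "b > 0" for b
  proof -
    have "(\<integral>\<^sup>+\<omega>. \<rho> b \<omega> \<partial>M) \<le> liminf (\<lambda>N. \<integral>\<^sup>+\<omega>. ennreal (Q b N \<omega>) \<partial>M)"
      unfolding \<rho>_def using Qm[OF b] by (rule nn_integral_liminf)
    also have "\<dots> \<le> ennreal (C * b)"
    proof (rule Liminf_le)
      obtain N0 where N0: "b \<le> real N0" using real_arch_simple by blast
      show "\<forall>\<^sub>F N in sequentially. (\<integral>\<^sup>+\<omega>. ennreal (Q b N \<omega>) \<partial>M) \<le> ennreal (C * b)"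
        unfolding eventually_sequentially
      proof (intro exI[of _ "Suc N0"] allI impI)
        fix N assume N: "Suc N0 \<le> N"
        define d where "d = b / real N"
        have d: "d > 0" "d \<le> 1" "real N * d = b" using b N N0 by (auto simp: d_def)
        have "(\<integral>\<^sup>+\<omega>. ennreal (Q b N \<omega>) \<partial>M) = ennreal (expectation (Q b N))"
          using QL2(1)[OF b, of N] N Qpos by (intro nn_integral_eq_integral) auto
        also have "expectation (Q b N) \<le> real N * (K\<^sup>2 * d) + real N * (K\<^sup>2 * (2 * d\<^sup>2)) + real N * (2 * d\<^sup>2)"
          using QL2(2)[OF b, of N] N by (simp add: d_def)
        also have "\<dots> = K\<^sup>2 * b + 2 * K\<^sup>2 * (b * d) + 2 * (b * d)"
          using d(3) by (simp add: power2_eq_square algebra_simps flip: d(3))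
        also have "\<dots> \<le> K\<^sup>2 * b + 2 * K\<^sup>2 * (b * 1) + 2 * (b * 1)"
          using d b by (intro add_mono mult_left_mono) auto
        also have "\<dots> = C * b" by (simp add: C_def algebra_simps)
        finally show "(\<integral>\<^sup>+\<omega>. ennreal (Q b N \<omega>) \<partial>M) \<le> ennreal (C * b)" by (simp add: ennreal_leI)
      qed
    qed simp
    finally show ?thesis .
  qed
  have C: "C > 0" by (simp add: C_def add_nonneg_pos)
  define s where "s k = (real (Suc k))\<^sup>2" for k
  have s: "s k > 0" for k by (simp add: s_def)
  define f where "f k \<omega> = ennreal (1 / (s k)\<^sup>2) * \<rho> (s k) \<omega>" for k \<omega>
  have fm: "f k \<in> borel_measurable M" for k
    unfolding f_def[abs_def] using \<rho>m[OF s] by simp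
  have "(\<integral>\<^sup>+\<omega>. (\<Sum>k. f k \<omega>) \<partial>M) = (\<Sum>k. \<integral>\<^sup>+\<omega>. f k \<omega> \<partial>M)"
    using fm by (rule nn_integral_suminf)
  also have "\<dots> \<le> (\<Sum>k. ennreal (C * (1 / s k)))"
  proof (intro suminf_le summableI)
    fix k
    have "(\<integral>\<^sup>+\<omega>. f k \<omega> \<partial>M) = ennreal (1 / (s k)\<^sup>2) * (\<integral>\<^sup>+\<omega>. \<rho> (s k) \<omega> \<partial>M)"
      unfolding f_def using \<rho>m[OF s] by (rule nn_integral_cmult)
    also have "\<dots> \<le> ennreal (1 / (s k)\<^sup>2) * ennreal (C * s k)"
      using \<rho>int[OF s] by (intro mult_left_mono) auto
    also have "\<dots> = ennreal (C * (1 / s k))"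
      using s[of k] C by (simp add: power2_eq_square flip: ennreal_mult)
    finally show "(\<integral>\<^sup>+\<omega>. f k \<omega> \<partial>M) \<le> ennreal (C * (1 / s k))" .
  qed
  also have "\<dots> = ennreal (\<Sum>k. C * (1 / s k))"
  proof (rule suminf_ennreal2)
    show "summable (\<lambda>k. C * (1 / s k))"
      unfolding s_def using inverse_squares_sums by (intro summable_mult) (auto simp: sums_iff)
  qed (use C s in \<open>simp add: less_imp_le\<close>)
  finally have "(\<integral>\<^sup>+\<omega>. (\<Sum>k. f k \<omega>) \<partial>M) \<noteq> \<infinity>" using neq_top_trans[OF ennreal_neq_top] by (simp add: infinity_ennreal_def)
  then have "AE \<omega> in M. (\<Sum>k. f k \<omega>) \<noteq> \<infinity>"
    using fm by (intro nn_integral_PInf_AE borel_measurable_suminf_order) auto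
  with continuous_paths show ?thesis
  proof eventually_elim
    case (elim \<omega>)
    define x where "x = (\<lambda>u. W u \<omega> + \<mu> * u)"
    have cont: "continuous_on {0..b} x" for b
      unfolding x_def by (intro continuous_intros continuous_on_subset[OF elim(1)]) auto
    have ftop: "f k \<omega> < \<top>" for k
      using elim(2) ennreal_suminf_lessD[of "\<lambda>k. f k \<omega>" \<top> k] by (simp add: less_top infinity_ennreal_def)
    have \<rho>fin: "\<rho> (s k) \<omega> < \<top>" for k
      using ftop[of k] s[of k] unfolding f_def by (auto simp: ennreal_mult_less_top)
    define a where "a k = enn2real (\<rho> (s k) \<omega>) / (s k)\<^sup>2" for k
    have fa: "f k \<omega> = ennreal (a k)" for k
    proof -
      have "\<rho> (s k) \<omega> = ennreal (enn2real (\<rho> (s k) \<omega>))" using \<rho>fin[of k] by simp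
      then have "f k \<omega> = ennreal (1 / (s k)\<^sup>2) * ennreal (enn2real (\<rho> (s k) \<omega>))" unfolding f_def by simp
      also have "\<dots> = ennreal (a k)" by (simp add: a_def flip: ennreal_mult)
      finally show ?thesis .
    qed
    have "summable a"
      using elim(2) unfolding fa by (intro summable_suminf_not_top) (auto simp: a_def)
    then have a0: "a \<longlonglongrightarrow> 0" by (rule summable_LIMSEQ_zero)
    have s1: "(\<lambda>k. 1 / (s k)\<^sup>2) \<longlonglongrightarrow> 0" "(\<lambda>k. (2 * K + 2) / s k) \<longlonglongrightarrow> 0"
      unfolding s_def by real_asymp+
    have bound: "\<bar>enn2real (UTV c x 0 (s k)) / s k - \<kappa>\<bar> \<le> 2 * sqrt (a k + 1 / (s k)\<^sup>2) + (2 * K + 2) / s k" for k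
    proof -
      have "\<bar>enn2real (UTV c x 0 (s k)) - \<kappa> * s k\<bar>
        \<le> 2 * sqrt (enn2real (liminf (\<lambda>N. ennreal (Q (s k) N \<omega>))) + 1) + 2 * K + 2"
      proof (rule UTV_near_linear[OF co cont s c, where w = "\<lambda>N j. w (s k) N j \<omega>" and Y = "\<lambda>N j. Y (s k) N j \<omega>"])
        show "x (real (Suc j) * (s k / real N)) - x (real j * (s k / real N)) = w (s k) N j \<omega> + \<mu> * (s k / real N)" for N j
        proof -
          have "\<mu> * (real (Suc j) * t) - \<mu> * (real j * t) = \<mu> * t" for t by (simp add: algebra_simps)
          from this[of "s k / real N"] show ?thesis unfolding x_def w_def by linarith
        qed
        show "Y (s k) N j \<omega> = refl_path c (\<lambda>j. w (s k) N j \<omega> + \<mu> * (s k / real N)) j" for N j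
          by (simp only: Y_def)
        show "Q (s k) N \<omega> = (\<Sum>j<N. g (Y (s k) N j \<omega>) * w (s k) N j \<omega>)\<^sup>2 +
          (\<Sum>j<N. g' (Y (s k) N j \<omega>) / 2 * ((w (s k) N j \<omega>)\<^sup>2 - s k / real N))\<^sup>2 +
          (\<Sum>j<N. (w (s k) N j \<omega>)\<^sup>2 - s k / real N)\<^sup>2" for N
          by (simp only: Q_def)
        show "liminf (\<lambda>N. ennreal (Q (s k) N \<omega>)) < \<top>" using \<rho>fin[of k] by (simp add: \<rho>_def)
      qed
      then have "\<bar>enn2real (UTV c x 0 (s k)) - \<kappa> * s k\<bar> / s k
        \<le> (2 * sqrt (enn2real (\<rho> (s k) \<omega>) + 1) + (2 * K + 2)) / s k"
        using s[of k] by (intro divide_right_mono) (auto simp: \<rho>_def)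
      also have "\<dots> = 2 * (sqrt (enn2real (\<rho> (s k) \<omega>) + 1) / s k) + (2 * K + 2) / s k"
        by (simp add: add_divide_distrib)
      also have "sqrt (enn2real (\<rho> (s k) \<omega>) + 1) / s k = sqrt (a k + 1 / (s k)\<^sup>2)"
        using s[of k] by (simp add: a_def real_sqrt_divide flip: add_divide_distrib)
      also have "\<bar>enn2real (UTV c x 0 (s k)) - \<kappa> * s k\<bar> / s k = \<bar>enn2real (UTV c x 0 (s k)) / s k - \<kappa>\<bar>"
      proof -
        have "enn2real (UTV c x 0 (s k)) / s k - \<kappa> = (enn2real (UTV c x 0 (s k)) - \<kappa> * s k) / s k"
          using s[of k] by (simp add: field_simps)
        then show ?thesis using s[of k] by (simp add: abs_divide)
      qed
      finally show ?thesis .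
    qed
    have "(\<lambda>k. 2 * sqrt (a k + 1 / (s k)\<^sup>2) + (2 * K + 2) / s k) \<longlonglongrightarrow> 2 * sqrt (0 + 0) + 0"
      by (intro tendsto_intros a0 s1)
    then have null: "(\<lambda>k. 2 * sqrt (a k + 1 / (s k)\<^sup>2) + (2 * K + 2) / s k) \<longlonglongrightarrow> 0"
      by (simp only: add_0_left real_sqrt_zero mult_zero_right)
    have "(\<lambda>k. enn2real (UTV c x 0 (s k)) / s k - \<kappa>) \<longlonglongrightarrow> 0"
    proof (rule Lim_null_comparison[OF _ null])
      show "\<forall>\<^sub>F k in sequentially. norm (enn2real (UTV c x 0 (s k)) / s k - \<kappa>)
          \<le> 2 * sqrt (a k + 1 / (s k)\<^sup>2) + (2 * K + 2) / s k"
        unfolding real_norm_def by (intro always_eventually allI bound)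
    qed
    then have "(\<lambda>k. enn2real (UTV c x 0 (s k)) / s k) \<longlonglongrightarrow> \<kappa>" by (simp add: LIM_zero_iff)
    then have "(\<lambda>k. enn2real (UTV c x 0 ((real k)\<^sup>2)) / (real k)\<^sup>2) \<longlonglongrightarrow> \<kappa>"
      unfolding s_def by (rule LIMSEQ_imp_Suc)
    then show ?case by (simp add: x_def \<kappa>_def)
  qed
qed

lemma standard_brownian_motion_uminus: "standard_brownian_motion M (\<lambda>t \<omega>. - W t \<omega>)"
proof unfold_locales
  show "(\<lambda>\<omega>. - W t \<omega>) \<in> borel_measurable M" if "0 \<le> t" for t using measurable[OF that] by simp
  show "AE \<omega> in M. - W 0 \<omega> = 0" using start by simp
  show "AE \<omega> in M. continuous_on {0..} (\<lambda>t. - W t \<omega>)"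
    using continuous_paths by eventually_elim (intro continuous_intros)
  show "indep_vars (\<lambda>_. borel) (\<lambda>i \<omega>. - W (t (Suc i)) \<omega> - - W (t i) \<omega>) {..<n}"
    if "0 \<le> t 0" "strict_mono_on {..n} t" for n :: nat and t
    using indep_vars_compose2[OF indep_increments[OF that], of "\<lambda>_ x. - x" "\<lambda>_. borel"] by simp
  show "distributed M lborel (\<lambda>\<omega>. - W t \<omega> - - W s \<omega>) (normal_density 0 (sqrt (t - s)))"
    if "0 \<le> s" "s < t" for s t
    using normal_density_affine[OF gaussian_increments[OF that], of "-1" 0] that by simp
qed

end

section \<open>From square times to uniform convergence\<close>

text \<open>Consecutive squares have ratio tending to one, so monotonicity fills the gaps between them.\<close>

lemma ratio_limit_from_squares:
  fixes w :: "real \<Rightarrow> real"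
  assumes mono: "\<And>x y. 0 \<le> x \<Longrightarrow> x \<le> y \<Longrightarrow> w x \<le> w y" and nonneg: "\<And>x. 0 \<le> w x"
    and lim: "(\<lambda>k. w ((real k)\<^sup>2) / (real k)\<^sup>2) \<longlonglongrightarrow> \<kappa>" and e: "e > 0"
  obtains S where "S > 0" "\<And>t. t \<ge> S \<Longrightarrow> \<bar>w t - \<kappa> * t\<bar> \<le> e * t"
proof -
  define a where "a k = w ((real k)\<^sup>2) / (real k)\<^sup>2" for k
  have r1: "(\<lambda>k. (real k)\<^sup>2 / (real (Suc k))\<^sup>2) \<longlonglongrightarrow> 1"
    and r2: "(\<lambda>k. (real (Suc k))\<^sup>2 / (real k)\<^sup>2) \<longlonglongrightarrow> 1" by real_asymp+
  have lim: "a \<longlonglongrightarrow> \<kappa>" using lim by (simp add: a_def[abs_def])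
  have l1: "(\<lambda>k. a k * ((real k)\<^sup>2 / (real (Suc k))\<^sup>2)) \<longlonglongrightarrow> \<kappa>"
    using tendsto_mult[OF lim r1] by simp
  have l2: "(\<lambda>k. a (Suc k) * ((real (Suc k))\<^sup>2 / (real k)\<^sup>2)) \<longlonglongrightarrow> \<kappa>"
    using tendsto_mult[OF LIMSEQ_Suc[OF lim] r2] by simp
  have "eventually (\<lambda>k. \<kappa> - e < a k * ((real k)\<^sup>2 / (real (Suc k))\<^sup>2) \<and>
      a (Suc k) * ((real (Suc k))\<^sup>2 / (real k)\<^sup>2) < \<kappa> + e) sequentially"
    using order_tendstoD(1)[OF l1, of "\<kappa> - e"] order_tendstoD(2)[OF l2, of "\<kappa> + e"] e
    by (auto intro: eventually_conj)
  then obtain K where K: "\<And>k. k \<ge> K \<Longrightarrow> \<kappa> - e < a k * ((real k)\<^sup>2 / (real (Suc k))\<^sup>2) \<and>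
      a (Suc k) * ((real (Suc k))\<^sup>2 / (real k)\<^sup>2) < \<kappa> + e"
    unfolding eventually_sequentially by blast
  show ?thesis
  proof (rule that[of "(real (Suc K))\<^sup>2"])
    fix t assume t: "t \<ge> (real (Suc K))\<^sup>2"
    define k where "k = nat \<lfloor>sqrt t\<rfloor>"
    have st: "sqrt t \<ge> real (Suc K)" using t real_le_rsqrt by blast
    have "0 \<le> sqrt t" using st of_nat_0_le_iff[of "Suc K"] by linarith
    then have "real k = of_int \<lfloor>sqrt t\<rfloor>" by (simp add: k_def)
    then have k: "k \<ge> Suc K" "real k \<le> sqrt t" "sqrt t < real (Suc k)"
      using st le_nat_floor[OF st] by (auto simp: k_def) linarith
    have t0: "t > 0" using t by (smt (verit) zero_less_power2 of_nat_0 of_nat_Suc of_nat_0_le_iff)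
    have kt: "(real k)\<^sup>2 \<le> t"
      using k(2) t0 by (metis less_imp_le of_nat_0_le_iff power_mono real_sqrt_pow2)
    have tk: "t \<le> (real (Suc k))\<^sup>2"
      using k(3) t0 by (metis less_imp_le real_sqrt_ge_0_iff power_mono real_sqrt_pow2)
    have kp: "real k > 0" using k by simp
    have "\<kappa> - e < w ((real k)\<^sup>2) / (real (Suc k))\<^sup>2"
      using K[of k] k kp by (simp add: a_def)
    also have "\<dots> \<le> w t / t"
      using mono[of "(real k)\<^sup>2" t] kt tk t0 nonneg by (intro frac_le) auto
    finally have lo: "(\<kappa> - e) * t \<le> w t" using t0 by (simp add: pos_less_divide_eq)
    have "w t / t \<le> w ((real (Suc k))\<^sup>2) / (real k)\<^sup>2"
      using mono[of t "(real (Suc k))\<^sup>2"] kt tk t0 kp nonneg by (intro frac_le) auto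
    also have "\<dots> < \<kappa> + e" using K[of k] k kp by (simp add: a_def)
    finally have "w t \<le> (\<kappa> + e) * t" using t0 by (simp add: pos_divide_less_eq)
    then show "\<bar>w t - \<kappa> * t\<bar> \<le> e * t" using lo by (simp add: algebra_simps abs_le_iff)
  qed simp
qed

text \<open>By scaling, the error at \<open>t\<close> is \<open>\<bar>w s - \<kappa> s\<bar> / n\<close> with \<open>s = n t \<le> n T\<close>: for large \<open>s\<close> it is at
  most a small multiple of \<open>s / n \<le> T\<close>, for bounded \<open>s\<close> a constant divided by \<open>n\<close>.\<close>

lemma converges_in_C_from_squares:
  fixes v :: "real \<Rightarrow> ennreal"
  assumes fin: "\<And>t. 0 \<le> t \<Longrightarrow> v t < \<top>"
    and mono: "\<And>x y. 0 \<le> x \<Longrightarrow> x \<le> y \<Longrightarrow> v x \<le> v y"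
    and cont: "\<And>b. 0 \<le> b \<Longrightarrow> continuous_on {0..b} (\<lambda>t. enn2real (v t))"
    and lim: "(\<lambda>k. enn2real (v ((real k)\<^sup>2)) / (real k)\<^sup>2) \<longlonglongrightarrow> \<kappa>" and T: "T > 0"
  shows "converges_in_C T (\<lambda>n t. v (real n * t) / of_nat n) (\<lambda>t. \<kappa> * t)"
proof -
  define w where "w t = enn2real (v t)" for t
  have wmono: "w x \<le> w y" if "0 \<le> x" "x \<le> y" for x y
    unfolding w_def using that mono fin[of y] by (intro enn2real_mono) auto
  have wnonneg: "0 \<le> w x" for x by (simp add: w_def)
  have eq: "enn2real (v (real n * t) / of_nat n) = w (real n * t) / real n" for n t
    by (cases "n = 0")
      (simp_all add: w_def divide_ennreal_def enn2real_mult ennreal_of_nat_eq_real_of_nat inverse_ennreal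
        divide_inverse)
  have contn: "continuous_on {0..T} (\<lambda>t. w (real n * t) / real n)" for n
  proof -
    have "continuous_on {0..T} (\<lambda>t. w (real n * t))"
      by (rule continuous_on_compose2[OF cont[of "real n * T", folded w_def]])
        (use T in \<open>auto intro!: continuous_intros mult_left_mono\<close>)
    then show ?thesis by (cases "n = 0") (auto intro!: continuous_intros)
  qed
  have unif: "uniform_limit {0..T} (\<lambda>n t. w (real n * t) / real n) (\<lambda>t. \<kappa> * t) sequentially"
  proof (rule uniform_limitI)
    fix e :: real assume e: "e > 0"
    define e' where "e' = e / (2 * T)"
    have e': "e' > 0" "e' * T < e" using e T by (simp_all add: e'_def)
    obtain S where S: "S > 0" "\<And>t. t \<ge> S \<Longrightarrow> \<bar>w t - \<kappa> * t\<bar> \<le> e' * t"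
      using ratio_limit_from_squares[of w \<kappa> e'] wmono wnonneg lim e' unfolding w_def by blast
    define B where "B = w S + \<bar>\<kappa>\<bar> * S"
    obtain N where N: "B / e < real N" using reals_Archimedean2 by blast
    show "eventually (\<lambda>n. \<forall>t\<in>{0..T}. dist (w (real n * t) / real n) (\<kappa> * t) < e) sequentially"
      unfolding eventually_sequentially
    proof (intro exI[of _ "Suc N"] allI impI ballI)
      fix n t assume n: "Suc N \<le> n" and t: "t \<in> {0..T}"
      have "B / e < real n" using N n by simp
      then have nB: "B < e * real n" using e by (simp add: pos_divide_less_eq mult.commute)
      have n0: "real n > 0" using n by simp
      have "\<bar>w (real n * t) - \<kappa> * (real n * t)\<bar> < e * real n"
      proof (cases "real n * t \<ge> S")
        case True
        have "e' * (real n * t) \<le> real n * (e' * T)" using t e' n0 by (simp add: mult_left_mono)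
        also have "\<dots> < e * real n" using e'(2) n0 by (simp add: mult.commute)
        finally show ?thesis using S(2)[OF True] by linarith
      next
        case False
        have "w (real n * t) \<le> w S" using False t n0 by (intro wmono) auto
        moreover have "\<bar>\<kappa> * (real n * t)\<bar> \<le> \<bar>\<kappa>\<bar> * S"
          using False t n0 by (simp add: abs_mult mult_left_mono)
        ultimately show ?thesis using nB wnonneg[of "real n * t"] unfolding B_def by linarith
      qed
      moreover have "dist (w (real n * t) / real n) (\<kappa> * t) = \<bar>w (real n * t) - \<kappa> * (real n * t)\<bar> / real n"
      proof -
        have "w (real n * t) / real n - \<kappa> * t = (w (real n * t) - \<kappa> * (real n * t)) / real n"
          using n0 by (simp add: field_simps)
        then show ?thesis using n0 by (simp add: dist_real_def abs_divide)
      qed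
      ultimately show "dist (w (real n * t) / real n) (\<kappa> * t) < e"
        using n0 by (simp add: pos_divide_less_eq)
    qed
  qed
  have "v (real n * t) / of_nat n < \<top>" if "n \<ge> 1" "t \<in> {0..T}" for n t
  proof -
    have "v (real n * t) = ennreal (w (real n * t))" using fin[of "real n * t"] that by (simp add: w_def)
    then show ?thesis using that wnonneg by (simp add: ennreal_of_nat_eq_real_of_nat divide_ennreal)
  qed
  then show ?thesis
    unfolding converges_in_C_def eq using contn unif by (auto intro!: continuous_intros)
qed

lemma UTV_converges_in_C:
  assumes c: "c > 0" and T: "T > 0" and cont: "continuous_on {0..} f"
    and lim: "(\<lambda>k. enn2real (UTV c f 0 ((real k)\<^sup>2)) / (real k)\<^sup>2) \<longlonglongrightarrow> \<kappa>"
  shows "converges_in_C T (\<lambda>n t. UTV c f 0 (real n * t) / of_nat n) (\<lambda>t. \<kappa> * t)"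
proof (rule converges_in_C_from_squares[OF _ _ _ lim T])
  have cont: "continuous_on {0..b} f" for b by (rule continuous_on_subset[OF cont]) auto
  show "UTV c f 0 t < \<top>" if "0 \<le> t" for t by (rule UTV_finite[OF c cont that])
  show "continuous_on {0..b} (\<lambda>t. enn2real (UTV c f 0 t))" for b by (rule UTV_continuous[OF cont c])
qed (rule UTV_mono)

lemma TV_converges_in_C:
  assumes c: "c > 0" and T: "T > 0" and cont: "continuous_on {0..} f"
    and limU: "(\<lambda>k. enn2real (UTV c f 0 ((real k)\<^sup>2)) / (real k)\<^sup>2) \<longlonglongrightarrow> \<kappa>"
    and limD: "(\<lambda>k. enn2real (DTV c f 0 ((real k)\<^sup>2)) / (real k)\<^sup>2) \<longlonglongrightarrow> \<kappa>'"
  shows "converges_in_C T (\<lambda>n t. TV c f 0 (real n * t) / of_nat n) (\<lambda>t. (\<kappa> + \<kappa>') * t)"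
proof (rule converges_in_C_from_squares[OF _ _ _ _ T])
  have cont: "continuous_on {0..b} f" for b by (rule continuous_on_subset[OF cont]) auto
  show "TV c f 0 t < \<top>" if "0 \<le> t" for t by (rule TV_finite[OF c cont that])
  show "continuous_on {0..b} (\<lambda>t. enn2real (TV c f 0 t))" for b by (rule TV_continuous[OF cont c])
  let ?T = "\<lambda>k. enn2real (TV c f 0 ((real k)\<^sup>2))" and ?U = "\<lambda>k. enn2real (UTV c f 0 ((real k)\<^sup>2))"
    and ?D = "\<lambda>k. enn2real (DTV c f 0 ((real k)\<^sup>2))"
  have "(\<lambda>k. ?T k / (real k)\<^sup>2 - (?U k / (real k)\<^sup>2 + ?D k / (real k)\<^sup>2)) \<longlonglongrightarrow> 0"
  proof (rule Lim_null_comparison)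
    show "\<forall>\<^sub>F k in sequentially. norm (?T k / (real k)\<^sup>2 - (?U k / (real k)\<^sup>2 + ?D k / (real k)\<^sup>2)) \<le> 2 * c / (real k)\<^sup>2"
      using eventually_gt_at_top[of 0]
    proof eventually_elim
      case (elim k)
      then have k: "(real k)\<^sup>2 > 0" by simp
      have "?T k / (real k)\<^sup>2 - (?U k / (real k)\<^sup>2 + ?D k / (real k)\<^sup>2) = (?T k - (?U k + ?D k)) / (real k)\<^sup>2"
        by (simp add: diff_divide_distrib add_divide_distrib)
      then show ?case
        using TV_UTV_DTV[OF cont k c] k by (simp add: abs_divide divide_right_mono)
    qed
    show "(\<lambda>k. 2 * c / (real k)\<^sup>2) \<longlonglongrightarrow> 0" by real_asymp
  qed
  from tendsto_add[OF this tendsto_add[OF limU limD]]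
  show "(\<lambda>k. ?T k / (real k)\<^sup>2) \<longlonglongrightarrow> \<kappa> + \<kappa>'" by simp
qed (rule TV_mono)

lemma m_const_eq: "m_const c \<mu> = 1 / 2 * n_const c \<mu> + 1 / 2 * n_const c (- \<mu>)"
  by (simp add: m_const_def n_const_def coth_def field_simps)

theorem fact11:
  fixes M :: "'a measure" and W X :: "real \<Rightarrow> 'a \<Rightarrow> real" and \<mu> T c :: real
  assumes "standard_brownian_motion M W"
    and "\<And>t \<omega>. 0 \<le> t \<Longrightarrow> \<omega> \<in> space M \<Longrightarrow> X t \<omega> = W t \<omega> + \<mu> * t"
    and "T > 0" and "c > 0"
  shows "AE \<omega> in M.
    converges_in_C T (\<lambda>n t. TV c (\<lambda>u. X u \<omega>) 0 (real n * t) / of_nat n)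
      (\<lambda>t. m_const c \<mu> * t) \<and>
    converges_in_C T (\<lambda>n t. UTV c (\<lambda>u. X u \<omega>) 0 (real n * t) / of_nat n)
      (\<lambda>t. 1 / 2 * n_const c \<mu> * t) \<and>
    converges_in_C T (\<lambda>n t. DTV c (\<lambda>u. X u \<omega>) 0 (real n * t) / of_nat n)
      (\<lambda>t. 1 / 2 * n_const c (- \<mu>) * t)"
proof -
  interpret standard_brownian_motion M W by fact
  interpret neg: standard_brownian_motion M "\<lambda>t \<omega>. - W t \<omega>" by (rule standard_brownian_motion_uminus)
  note T = \<open>T > 0\<close> and c = \<open>c > 0\<close>
  show ?thesis
    using continuous_paths AE_UTV_squares[OF c, of \<mu>] neg.AE_UTV_squares[OF c, of "- \<mu>"] AE_space
  proof eventually_elim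
    case (elim \<omega>)
    define f where "f = (\<lambda>u. W u \<omega> + \<mu> * u)"
    have X: "X u \<omega> = f u" if "0 \<le> u" for u using assms(2) that elim(4) by (simp add: f_def)
    have eqs: "TV c (\<lambda>u. X u \<omega>) 0 b = TV c f 0 b" "UTV c (\<lambda>u. X u \<omega>) 0 b = UTV c f 0 b"
      "DTV c (\<lambda>u. X u \<omega>) 0 b = UTV c (\<lambda>u. - f u) 0 b" for b
      unfolding DTV_eq_UTV by (auto intro!: TV_cong UTV_cong simp: X)
    have cont: "continuous_on {0..} f" "continuous_on {0..} (\<lambda>u. - f u)"
      unfolding f_def by (intro continuous_intros elim(1))+
    have limU: "(\<lambda>k. enn2real (UTV c f 0 ((real k)\<^sup>2)) / (real k)\<^sup>2) \<longlonglongrightarrow> 1 / 2 * n_const c \<mu>"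
      using elim(2) by (simp add: f_def)
    have "(\<lambda>u. - W u \<omega> + - \<mu> * u) = (\<lambda>u. - f u)" by (simp add: f_def fun_eq_iff)
    with elim(3) have limD: "(\<lambda>k. enn2real (UTV c (\<lambda>u. - f u) 0 ((real k)\<^sup>2)) / (real k)\<^sup>2) \<longlonglongrightarrow> 1 / 2 * n_const c (- \<mu>)"
      by simp
    show ?case
      unfolding eqs m_const_eq
      using TV_converges_in_C[OF c T cont(1) limU limD[folded DTV_eq_UTV]]
        UTV_converges_in_C[OF c T cont(1) limU] UTV_converges_in_C[OF c T cont(2) limD]
      by blast
  qed
qed

end
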